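(* Let $n\ge 1$ and let $\mathbb{RP}^n\subset\mathbb{P}^n$ be the set of real points of complex projective space $\mathbb{P}^n$. The unweighted $\omega$-psh extremal function $v_{\mathbb{RP}^n,0}$ of $\mathbb{RP}^n$ is given by $$v_{\mathbb{RP}^n,0}([1:z])=\frac{1}{2}\log\Bigl([1+|z|^2]+\bigl\{[1+|z|^2]^2-|1+z^2|^2\bigr\}^{1/2}\Bigr)-u_0(z)=\frac{1}{2}\log\Bigl(1+\Bigl[1-\frac{|1+z^2|^2}{(1+|z|^2)^2}\Bigr]^{1/2}\Bigr)$$ for $z\in\mathbb{C}^n$ (so $[1:z]$ ranges over the affine chart $\mathbb{C}^n\subset\mathbb{P}^n$), and $$v_{\mathbb{RP}^n,0}([0:z])=\frac{1}{2}\log\Bigl(1+\Bigl[1-\frac{|z^2|^2}{(|z|^2)^2}\Bigr]^{1/2}\Bigr)$$ for $z\in\mathbb{C}^n\setminus\{0\}$.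
   Context: For $z=(z_1,\dots,z_n)\in\mathbb{C}^n$ write $z^2:=z_1^2+\cdots+z_n^2$, $|z|^2:=|z_1|^2+\cdots+|z_n|^2$ and $u_0(z):=\frac12\log(1+|z|^2)$. Points of $\mathbb{P}^n$ are written in homogeneous coordinates $[z_0:z_1:\cdots:z_n]$, and $\mathbb{C}^n$ is identified with $\{[1:z_1:\cdots:z_n]\}$. Let $\omega$ be the Fubini-Study K\"ahler form on $\mathbb{P}^n$ normalized so that $\int_{\mathbb{P}^n}\omega^n=1$, with $dd^c=\frac{i}{\pi}\partial\bar\partial$, so that $\omega=dd^cu_0$ on $\mathbb{C}^n$. The $\omega$-psh functions are $$PSH(\mathbb{P}^n,\omega):=\{\phi\in L^1(\mathbb{P}^n):\ \phi\text{ upper semicontinuous},\ dd^c\phi+\omega\ge 0\}.$$ For a closed set $K\subset\mathbb{P}^n$ and a function $q$ on $K$, $$v_{K,q}(\mathbf{z}):=\sup\{\phi(\mathbf{z}):\ \phi\in PSH(\mathbb{P}^n,\omega),\ \phi\le q\text{ on }K\},\qquad \mathbf{z}\in\mathbb{P}^n.$$ The unweighted case is $q=0$. *)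

theory Defs
  imports "HOL-Analysis.Analysis"
begin

section \<open>Plurisubharmonic functions\<close>

definition usc_on :: "'a::topological_space set \<Rightarrow> ('a \<Rightarrow> ereal) \<Rightarrow> bool" where
  "usc_on S u \<longleftrightarrow> (\<forall>c. openin (top_of_set S) {x \<in> S. u x < c})"

text \<open>The integral of an extended real function whose positive part has finite integral, with
  values in \<open>[-\<infinity>, \<infinity>)\<close>.  Note that \<^const>\<open>e2ennreal\<close> sends negative numbers to \<open>0\<close>, so the two
  terms are the integrals of the positive and of the negative part.\<close>

definition ereal_integral :: "'a measure \<Rightarrow> ('a \<Rightarrow> ereal) \<Rightarrow> ereal" where
  "ereal_integral M f =
     enn2ereal (\<integral>\<^sup>+ x. e2ennreal (f x) \<partial>M) - enn2ereal (\<integral>\<^sup>+ x. e2ennreal (- f x) \<partial>M)"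

text \<open>Functions with values in \<open>[-\<infinity>, \<infinity>)\<close> that are upper semicontinuous and satisfy the
  sub-mean value inequality on every closed disc, contained in the open set \<open>S\<close>, of a complex line.
  The function that is identically \<open>-\<infinity>\<close> is not excluded here; where it has to be excluded,
  integrability does so.\<close>

definition plurisubharmonic_on :: "(complex ^ 'n) set \<Rightarrow> (complex ^ 'n \<Rightarrow> ereal) \<Rightarrow> bool" where
  "plurisubharmonic_on S u \<longleftrightarrow>
     open S \<and> usc_on S u \<and> (\<forall>z\<in>S. u z < \<infinity>) \<and>
     (\<forall>a b. (\<forall>\<zeta>\<in>cball 0 1. a + \<zeta> *s b \<in> S) \<longrightarrow>
        u a \<le> ereal_integral (uniform_measure lborel {0..2 * pi}) (\<lambda>t. u (a + cis t *s b)))"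


section \<open>Complex projective space\<close>

text \<open>The complex lines through the origin of \<open>\<complex>\<^sup>m\<close>, where \<open>m = CARD('m)\<close>.  Projective
  \<open>n\<close>-space, with homogeneous coordinates \<open>[z\<^sub>0 : z\<^sub>1 : \<dots> : z\<^sub>n]\<close>, is \<open>'n option cproj\<close>
  with \<open>n = CARD('n)\<close>: the index of \<open>z\<^sub>0\<close> is \<^const>\<open>None\<close>.\<close>

typedef ('m::finite) cproj =
  "{L :: (complex ^ 'm) set. \<exists>v. v \<noteq> 0 \<and> L = vec.span {v}}"
proof -
  have "(axis undefined 1 :: complex ^ 'm) \<noteq> 0" by simp
  then show ?thesis by blast
qed

text \<open>The point with the homogeneous coordinate vector \<open>v\<close>; meaningful for \<open>v \<noteq> 0\<close> only.\<close>

definition point :: "complex ^ 'm \<Rightarrow> 'm::finite cproj" where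
  "point v = Abs_cproj (vec.span {v})"

lemma point_eq_iff:
  assumes "v \<noteq> 0" "w \<noteq> 0"
  shows "point v = point w \<longleftrightarrow> (\<exists>c. c \<noteq> 0 \<and> w = c *s v)"
proof -
  have "point v = point w \<longleftrightarrow> vec.span {v} = vec.span {w}"
    unfolding point_def using assms by (subst Abs_cproj_inject) auto
  also have "\<dots> \<longleftrightarrow> (\<exists>c. c \<noteq> 0 \<and> w = c *s v)"
  proof
    assume "vec.span {v} = vec.span {w}"
    then have "w \<in> vec.span {v}" using vec.span_base[of w "{w}"] by simp
    then obtain c where "w = c *s v" by (auto simp: vec.span_singleton)
    with assms show "\<exists>c. c \<noteq> 0 \<and> w = c *s v" by auto
  next
    assume "\<exists>c. c \<noteq> 0 \<and> w = c *s v"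
    then obtain c where c: "c \<noteq> 0" "w = c *s v" by blast
    have "k *s v \<in> range (\<lambda>l. l *s w)" for k
      using c by (intro image_eqI[of _ _ "k / c"]) auto
    with c show "vec.span {v} = vec.span {w}" by (auto simp: vec.span_singleton)
  qed
  finally show ?thesis .
qed

text \<open>The quotient topology.\<close>

instantiation cproj :: (finite) topological_space
begin

definition open_cproj :: "'a cproj set \<Rightarrow> bool" where
  "open U \<longleftrightarrow> open {v. v \<noteq> 0 \<and> point v \<in> U}"

instance
proof
  have "{v. v \<noteq> (0 :: complex ^ 'a) \<and> point v \<in> UNIV} = - {0}" by auto
  then show "open (UNIV :: 'a cproj set)"
    by (simp only: open_cproj_def open_Compl closed_singleton)
next
  fix S T :: "'a cproj set"
  assume "open S" "open T"
  moreover have "{v. v \<noteq> 0 \<and> point v \<in> S \<inter> T} =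
      {v. v \<noteq> 0 \<and> point v \<in> S} \<inter> {v. v \<noteq> 0 \<and> point v \<in> T}" by auto
  ultimately show "open (S \<inter> T)" by (simp only: open_cproj_def open_Int)
next
  fix K :: "'a cproj set set"
  assume "\<forall>S\<in>K. open S"
  moreover have "{v. v \<noteq> 0 \<and> point v \<in> \<Union> K} = (\<Union>S\<in>K. {v. v \<noteq> 0 \<and> point v \<in> S})" by auto
  ultimately show "open (\<Union> K)" by (auto simp only: open_cproj_def open_UN)
qed

end

definition hom_coords :: "complex \<Rightarrow> complex ^ 'n \<Rightarrow> complex ^ 'n option" where
  "hom_coords z0 z = (\<chi> i. case i of None \<Rightarrow> z0 | Some k \<Rightarrow> z $ k)"

text \<open>The \<open>j\<close>-th affine chart \<open>\<complex>\<^sup>n \<rightarrow> {Z\<^sub>j \<noteq> 0}\<close>: the coordinates with the indices \<open>0\<close> and \<open>j\<close> of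
  \<open>[1 : z]\<close> are exchanged.  For \<open>j = None\<close> this is \<open>z \<mapsto> [1 : z]\<close>.\<close>

definition affine_chart :: "'n option \<Rightarrow> complex ^ 'n \<Rightarrow> 'n::finite option cproj" where
  "affine_chart j z = point (\<chi> i. hom_coords 1 z $ Transposition.transpose None j i)"

definition real_points :: "'m::finite cproj set" where
  "real_points = {point (\<chi> i. complex_of_real (x $ i)) |x. x \<noteq> 0}"


section \<open>\<open>\<omega>\<close>-plurisubharmonic functions\<close>

definition u0 :: "complex ^ 'n \<Rightarrow> real" where
  "u0 z = 1/2 * ln (1 + (norm z)\<^sup>2)"

text \<open>The volume form \<open>\<omega>\<^sup>n\<close>.  The hyperplane at infinity is a null set, and on \<open>\<complex>\<^sup>n\<close>
  \[\omega^n = (dd^c u_0)^n = \frac{n!}{\pi^n} (1 + |z|^2)^{-(n+1)}\,d\lambda,\]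
  where \<open>\<lambda>\<close> is Lebesgue measure.\<close>

definition omega_volume :: "'n::finite option cproj measure" where
  "omega_volume =
     distr
       (density lborel
         (\<lambda>z :: complex ^ 'n.
            ennreal (fact CARD('n) / (pi ^ CARD('n) * (1 + (norm z)\<^sup>2) ^ (CARD('n) + 1)))))
       borel (\<lambda>z. point (hom_coords 1 z))"

text \<open>\<open>L\<^sup>1\<close> with respect to any smooth volume form, for which \<open>\<omega>\<^sup>n\<close> is taken.  The inequality
  \<open>dd\<^sup>c \<phi> + \<omega> \<ge> 0\<close> is understood, as usual for upper semicontinuous \<open>\<phi>\<close>, in the sense that the
  sum of \<open>\<phi>\<close> and a local potential of \<open>\<omega>\<close> is plurisubharmonic at every point (and not just almost
  everywhere equal to a plurisubharmonic function: otherwise the values of \<open>\<phi>\<close> could be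
  raised at single points and the extremal functions below would be infinite off \<open>K\<close>).
  Since \<open>\<omega>\<close> is unitarily invariant, \<open>u\<^sub>0\<close> is a potential of \<open>\<omega>\<close> in the coordinates of every
  affine chart.\<close>

definition PSH_omega :: "('n::finite option cproj \<Rightarrow> ereal) set" where
  "PSH_omega =
     {\<phi>. \<phi> \<in> borel_measurable borel \<and> (\<integral>\<^sup>+ p. e2ennreal \<bar>\<phi> p\<bar> \<partial>omega_volume) < \<infinity> \<and>
         usc_on UNIV \<phi> \<and>
         (\<forall>j. plurisubharmonic_on UNIV (\<lambda>z. \<phi> (affine_chart j z) + ereal (u0 z)))}"

definition extremal_fun ::
  "'n::finite option cproj set \<Rightarrow> ('n option cproj \<Rightarrow> ereal) \<Rightarrow> 'n option cproj \<Rightarrow> ereal" where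
  "extremal_fun K q p = (SUP \<phi> \<in> {\<phi> \<in> PSH_omega. \<forall>x\<in>K. \<phi> x \<le> q x}. \<phi> p)"

text \<open>The square \<open>z\<^sup>2 = z\<^sub>1\<^sup>2 + \<dots> + z\<^sub>n\<^sup>2\<close>; no complex conjugation is involved.\<close>

definition csquare :: "complex ^ 'n \<Rightarrow> complex" where
  "csquare z = (\<Sum>k\<in>UNIV. (z $ k)\<^sup>2)"

end

theory Submission
  imports Defs "HOL-Complex_Analysis.Cauchy_Integral_Formula"
begin

text \<open>
  In homogeneous coordinates $Z$, an \<open>\<omega>\<close>-plurisubharmonic function \<open>\<phi>\<close> is the same thing as the
  logarithmically homogeneous plurisubharmonic function $\phi([Z]) + \log|Z|$.  Both formulas to be
  proved are the single formula $v([Z]) = \log L(Z) - \log|Z|$, where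
  \[L(Z)^2 = |Z|^2 + \sqrt{|Z|^4 - |Z^2|^2}\]
  is the square of the Lie norm, the largest complex norm that extends the Euclidean norm of real
  vectors.  If $Z = X + iY$ with $X, Y$ real and $X'$ is the component of $X$ orthogonal to $Y$, then
  $L(Z)^2 = |X|^2 + |Y|^2 + 2|X'||Y|$.

  The function on the right is a competitor.  It vanishes on the real points, because there
  $|Z^2| = |Z|^2$.  It is \<open>\<omega>\<close>-plurisubharmonic, because $L$ is the maximum of the functions
  $|\ell|$ for the linear forms $\ell(Z) = Z \cdot (e - if)$ with $e, f$ real, orthogonal and of
  length at most $1$ (\<open>isotropic_form_le\<close>, \<open>isotropic_form_attains\<close>): the sub-mean value inequality
  for $\log L$ follows from Jensen's inequality for the one linear form that attains the maximum at
  the centre of the disc.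

  It is the largest one.  A point with $Z_j = 1$ that is not real can be written as $X' + \tau Y$ with
  $X', Y$ real and orthogonal, $Y_j = 0$ and ${\rm Im}\,\tau > 0$.  On the complex line
  $\tau \mapsto [X' + \tau Y]$ the real points are exactly the real \<open>\<tau>\<close> and the point at infinity,
  and for ${\rm Im}\,\tau \ge 0$ one has $L(X' + \tau Y) = \bigl| |X'| - i \tau |Y| \bigr|$, the
  modulus of an affine function of \<open>\<tau>\<close> without zeros there.  So $\phi + \log|Z| - \log L$ is
  subharmonic in the half plane and at most $0$ on its boundary including infinity, and the maximum
  principle (\<open>half_plane_maximum_principle\<close>) makes it at most $0$ everywhere.
\<close>

section \<open>Circle means of the logarithm of an affine function\<close>

text \<open>The affine function has no zero in the closed unit disc, so $\log|\alpha + \beta\zeta|$ is there the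
  real part of a holomorphic function, up to the constant $\log|\alpha|$, and Cauchy's integral
  formula gives its value at the centre as its mean over the unit circle.\<close>

lemma has_integral_ln_norm_affine:
  assumes "cmod \<beta> < cmod \<alpha>"
  shows "((\<lambda>t. ln (cmod (\<alpha> + \<beta> * cis t))) has_integral 2 * pi * ln (cmod \<alpha>)) {0..2 * pi}"
proof -
  define c where "c = \<beta> / \<alpha>"
  have \<alpha>: "\<alpha> \<noteq> 0" using assms by auto
  have c: "cmod c < 1" using assms \<alpha> by (simp add: c_def norm_divide)
  have pos: "0 < Re (1 + c * u)" if "cmod u \<le> 1" for u
  proof -
    have "cmod (c * u) < 1"
      using c that by (metis mult_left_le norm_ge_zero norm_mult order_le_less_trans)
    then show ?thesis using abs_Re_le_cmod[of "c * u"] by simp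
  qed
  have "(\<lambda>u. Ln (1 + c * u)) holomorphic_on cball 0 1"
    using pos by (intro holomorphic_intros) (force simp: complex_nonpos_Reals_iff)+
  then have "((\<lambda>u. Ln (1 + c * u) / (u - 0)) has_contour_integral
      2 * of_real pi * \<i> * Ln (1 + c * 0)) (circlepath 0 1)"
    by (rule Cauchy_integral_circlepath_simple) simp
  then have "((\<lambda>t. Ln (1 + c * cis t) * \<i>) has_integral 0) {0..2 * pi}"
    by (simp add: circlepath_def has_contour_integral_part_circlepath_iff)
  from has_integral_linear[OF this bounded_linear_Im]
  have "((\<lambda>t. Re (Ln (1 + c * cis t))) has_integral 0) {0..2 * pi}"
    by (simp add: o_def)
  moreover have "((\<lambda>t::real. ln (cmod \<alpha>)) has_integral 2 * pi * ln (cmod \<alpha>)) {0..2 * pi}"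
    using has_integral_const_real[of "ln (cmod \<alpha>)" 0 "2 * pi"] by simp
  ultimately have "((\<lambda>t. Re (Ln (1 + c * cis t)) + ln (cmod \<alpha>)) has_integral
      0 + 2 * pi * ln (cmod \<alpha>)) {0..2 * pi}"
    by (rule has_integral_add)
  moreover have "Re (Ln (1 + c * cis t)) + ln (cmod \<alpha>) = ln (cmod (\<alpha> + \<beta> * cis t))" for t
  proof -
    have ne: "1 + c * cis t \<noteq> 0" using pos[of "cis t"] by force
    have "\<alpha> + \<beta> * cis t = \<alpha> * (1 + c * cis t)" using \<alpha> by (simp add: c_def field_simps)
    then show ?thesis using ne \<alpha> by (simp add: norm_mult ln_mult)
  qed
  ultimately show ?thesis by simp
qed

text \<open>Jensen's inequality, which holds wherever the zero of $\alpha + \beta\zeta$ lies.  Stating it for a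
  nonnegative continuous majorant $f$ avoids integrals of functions with logarithmic poles: as
  $e^f \ge 1$, replacing \<open>\<alpha>\<close> by a slightly larger multiple of itself costs only a small additive
  error in $f$, and it removes the zero from the unit circle.  If the zero is then inside the disc,
  reflection in the circle exchanges the roles of the coefficients.\<close>

lemma ln_norm_le_integral:
  fixes f :: "real \<Rightarrow> real"
  assumes cont: "continuous_on {0..2 * pi} f"
    and nonneg: "\<And>t. 0 \<le> f t"
    and dom: "\<And>t. cmod (\<alpha> + \<beta> * cis t) \<le> exp (f t)"
    and \<alpha>: "\<alpha> \<noteq> 0"
  shows "2 * pi * ln (cmod \<alpha>) \<le> integral {0..2 * pi} f"
proof (rule field_le_epsilon)
  fix e :: real assume "0 < e"
  define \<delta> where "\<delta> = e / (2 * pi)"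
  have \<delta>: "0 < \<delta>" using \<open>0 < e\<close> by (simp add: \<delta>_def)
  \<comment> \<open>Of two admissible enlargements of \<open>\<alpha>\<close>, at least one avoids the modulus of \<open>\<beta>\<close>.\<close>
  have "\<exists>s>0. s * cmod \<alpha> \<le> \<delta> \<and> (1 + s) * cmod \<alpha> \<noteq> cmod \<beta>"
  proof (cases "cmod \<alpha> + \<delta> = cmod \<beta>")
    case True
    with \<delta> \<alpha> show ?thesis by (intro exI[of _ "\<delta> / 2 / cmod \<alpha>"]) (auto simp: distrib_right)
  next
    case False
    with \<delta> \<alpha> show ?thesis by (intro exI[of _ "\<delta> / cmod \<alpha>"]) (auto simp: distrib_right)
  qed
  then obtain s where s: "0 < s" "s * cmod \<alpha> \<le> \<delta>" "(1 + s) * cmod \<alpha> \<noteq> cmod \<beta>" by blast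
  define \<alpha>' where "\<alpha>' = of_real (1 + s) * \<alpha>"
  have n\<alpha>': "cmod \<alpha>' = (1 + s) * cmod \<alpha>"
    unfolding \<alpha>'_def norm_mult norm_of_real using s(1) by simp
  have ne: "cmod \<alpha>' \<noteq> cmod \<beta>" using s(3) n\<alpha>' by simp
  have le: "cmod \<alpha> \<le> cmod \<alpha>'" using s(1) by (simp add: n\<alpha>' mult_le_cancel_right1)
  have int: "((\<lambda>t. ln (cmod (\<alpha>' + \<beta> * cis t))) has_integral 2 * pi * ln (max (cmod \<alpha>') (cmod \<beta>)))
      {0..2 * pi}"
  proof (cases "cmod \<beta> < cmod \<alpha>'")
    case True
    then show ?thesis using has_integral_ln_norm_affine[OF True] by (simp add: max_def)
  next
    case False
    with ne have "cmod (cnj \<alpha>') < cmod (cnj \<beta>)" by simp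
    from has_integral_ln_norm_affine[OF this]
    have "((\<lambda>t. ln (cmod (cnj \<beta> + cnj \<alpha>' * cis t))) has_integral 2 * pi * ln (cmod \<beta>)) {0..2 * pi}"
      by simp
    moreover have "cmod (cnj \<beta> + cnj \<alpha>' * cis t) = cmod (\<alpha>' + \<beta> * cis t)" for t
    proof -
      have "cnj (cnj \<beta> + cnj \<alpha>' * cis t) * cis t = \<alpha>' + \<beta> * cis t"
        by (simp add: cis_cnj algebra_simps cis_mult)
      then have "cmod (\<alpha>' + \<beta> * cis t) = cmod (cnj (cnj \<beta> + cnj \<alpha>' * cis t))"
        by (metis norm_mult norm_cis mult.right_neutral)
      then show ?thesis by (simp only: complex_mod_cnj)
    qed
    ultimately show ?thesis using False by (simp add: max_def)
  qed
  have up: "ln (cmod (\<alpha>' + \<beta> * cis t)) \<le> f t + \<delta>" for t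
  proof -
    have "\<alpha>' + \<beta> * cis t \<noteq> 0"
    proof
      assume "\<alpha>' + \<beta> * cis t = 0"
      then have "\<alpha>' = - (\<beta> * cis t)" by (simp add: eq_neg_iff_add_eq_0)
      then have "cmod \<alpha>' = cmod \<beta>" by (simp add: norm_mult)
      with ne show False by simp
    qed
    moreover have "cmod (\<alpha>' + \<beta> * cis t) \<le> exp (f t + \<delta>)"
    proof -
      have "\<alpha>' + \<beta> * cis t = (\<alpha> + \<beta> * cis t) + of_real s * \<alpha>"
        by (simp add: \<alpha>'_def algebra_simps)
      then have "cmod (\<alpha>' + \<beta> * cis t) \<le> cmod (\<alpha> + \<beta> * cis t) + s * cmod \<alpha>"
        using s(1) norm_triangle_ineq[of "\<alpha> + \<beta> * cis t" "of_real s * \<alpha>"]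
        by (simp only: norm_mult norm_of_real abs_of_pos)
      also have "\<dots> \<le> exp (f t) + \<delta>" using dom[of t] s(2) by simp
      also have "\<dots> \<le> exp (f t) * (1 + \<delta>)" using nonneg[of t] \<delta>
        by (simp add: algebra_simps)
      also have "\<dots> \<le> exp (f t) * exp \<delta>" by (intro mult_left_mono exp_ge_add_one_self) simp
      finally show ?thesis by (simp add: exp_add)
    qed
    ultimately show ?thesis by (metis ln_exp ln_mono zero_less_norm_iff)
  qed
  have f: "(f has_integral integral {0..2 * pi} f) {0..2 * pi}"
    by (intro integrable_integral integrable_continuous_interval cont)
  have "((\<lambda>t. f t + \<delta>) has_integral integral {0..2 * pi} f + e) {0..2 * pi}"
    using has_integral_add[OF f has_integral_const_real[of \<delta> 0 "2 * pi"]] by (simp add: \<delta>_def)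
  from has_integral_le[OF int this up]
  have "2 * pi * ln (max (cmod \<alpha>') (cmod \<beta>)) \<le> integral {0..2 * pi} f + e" .
  moreover have "2 * pi * ln (cmod \<alpha>) \<le> 2 * pi * ln (max (cmod \<alpha>') (cmod \<beta>))"
    using le \<alpha> by (intro mult_left_mono) (auto intro!: ln_mono)
  ultimately show "2 * pi * ln (cmod \<alpha>) \<le> integral {0..2 * pi} f + e" by linarith
qed

section \<open>The Lie norm\<close>

definition Re_vec :: "complex ^ 'm \<Rightarrow> real ^ 'm" where
  "Re_vec Z = (\<chi> i. Re (Z $ i))"

definition Im_vec :: "complex ^ 'm \<Rightarrow> real ^ 'm" where
  "Im_vec Z = (\<chi> i. Im (Z $ i))"

definition cvec :: "real ^ 'm \<Rightarrow> complex ^ 'm" where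
  "cvec X = (\<chi> i. complex_of_real (X $ i))"

lemma Re_vec_cvec [simp]: "Re_vec (cvec X) = X" and Im_vec_cvec [simp]: "Im_vec (cvec X) = 0"
  by (auto simp: Re_vec_def Im_vec_def cvec_def vec_eq_iff)

lemma complex_vec_eq: "Z = cvec (Re_vec Z) + \<i> *s cvec (Im_vec Z)"
  by (simp add: Re_vec_def Im_vec_def cvec_def vec_eq_iff complex_eq)

lemma norm_sq_Re_Im: "(norm Z)\<^sup>2 = (norm (Re_vec Z))\<^sup>2 + (norm (Im_vec Z))\<^sup>2"
  for Z :: "complex ^ 'm"
  by (simp add: power2_norm_eq_inner inner_vec_def Re_vec_def Im_vec_def inner_complex_def
      sum.distrib)

lemma norm_scale: "norm (c *s Z) = cmod c * norm Z" for Z :: "complex ^ 'm"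
  by (simp add: norm_vec_def norm_mult L2_set_right_distrib)

lemma csquare_Re_Im:
  "csquare Z = Complex ((norm (Re_vec Z))\<^sup>2 - (norm (Im_vec Z))\<^sup>2) (2 * (Re_vec Z \<bullet> Im_vec Z))"
  for Z :: "complex ^ 'm"
  unfolding power2_norm_eq_inner
  by (simp add: csquare_def complex_eq_iff inner_vec_def Re_vec_def Im_vec_def
      sum_subtractf power2_eq_square sum_distrib_left mult_ac)

lemma csquare_scale: "csquare (c *s Z) = c\<^sup>2 * csquare Z"
  by (simp add: csquare_def power_mult_distrib sum_distrib_left)

text \<open>For $Y = 0$ the convention $x / 0 = 0$ gives $X$ itself.\<close>

definition perp :: "real ^ 'm \<Rightarrow> real ^ 'm \<Rightarrow> real ^ 'm" where
  "perp X Y = X - ((X \<bullet> Y) / (Y \<bullet> Y)) *\<^sub>R Y"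

lemma inner_perp: "perp X Y \<bullet> Y = 0"
  by (cases "Y = 0") (simp_all add: perp_def inner_diff_left)

lemma norm_perp:
  "(norm X)\<^sup>2 = (norm (perp X Y))\<^sup>2 + ((X \<bullet> Y) / (Y \<bullet> Y))\<^sup>2 * (norm Y)\<^sup>2"
proof -
  define s where "s = (X \<bullet> Y) / (Y \<bullet> Y)"
  have perp0: "perp X Y \<bullet> Y = 0" by (rule inner_perp)
  have "X = perp X Y + s *\<^sub>R Y" by (simp add: perp_def s_def)
  then have "X \<bullet> X = (perp X Y + s *\<^sub>R Y) \<bullet> (perp X Y + s *\<^sub>R Y)"
    by (rule arg_cong[where f = "\<lambda>v. v \<bullet> v"])
  also have "\<dots> = perp X Y \<bullet> perp X Y + s\<^sup>2 * (Y \<bullet> Y)"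
    using perp0 by (simp add: inner_add_left inner_add_right inner_commute power2_eq_square)
  finally show ?thesis unfolding power2_norm_eq_inner s_def .
qed

text \<open>The square of the Lie norm.\<close>

definition lie_sq :: "complex ^ 'm \<Rightarrow> real" where
  "lie_sq Z = (norm Z)\<^sup>2 + sqrt (((norm Z)\<^sup>2)\<^sup>2 - (cmod (csquare Z))\<^sup>2)"

text \<open>The left hand side is four times the Gram determinant of the real and the imaginary part of $Z$,
  that is, four times the squared area of the parallelogram that they span.\<close>

lemma gram_perp:
  "((norm Z)\<^sup>2)\<^sup>2 - (cmod (csquare Z))\<^sup>2 = (2 * (norm (perp (Re_vec Z) (Im_vec Z)) * norm (Im_vec Z)))\<^sup>2"
  for Z :: "complex ^ 'm"
proof -
  let ?X = "Re_vec Z" and ?Y = "Im_vec Z"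
  define s where "s = (?X \<bullet> ?Y) / (?Y \<bullet> ?Y)"
  define a b p where "a = (norm ?X)\<^sup>2" and "b = (norm ?Y)\<^sup>2" and "p = (norm (perp ?X ?Y))\<^sup>2"
  have s: "?X \<bullet> ?Y = s * b" by (cases "?Y = 0") (simp_all add: s_def b_def power2_norm_eq_inner)
  have a: "a = p + s\<^sup>2 * b" unfolding a_def b_def p_def s_def by (rule norm_perp)
  have "((norm Z)\<^sup>2)\<^sup>2 - (cmod (csquare Z))\<^sup>2 = (a + b)\<^sup>2 - ((a - b)\<^sup>2 + (2 * (s * b))\<^sup>2)"
    by (simp only: csquare_Re_Im norm_sq_Re_Im[of Z] cmod_power2 complex.sel s a_def b_def)
  also have "\<dots> = 4 * (p * b)"
    unfolding a by (simp add: power2_eq_square algebra_simps)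
  also have "\<dots> = (2 * (norm (perp ?X ?Y) * norm ?Y))\<^sup>2"
    by (simp add: p_def b_def power_mult_distrib)
  finally show ?thesis .
qed

lemma lie_sq_eq:
  "lie_sq Z = (norm (Re_vec Z))\<^sup>2 + (norm (Im_vec Z))\<^sup>2
     + 2 * (norm (perp (Re_vec Z) (Im_vec Z)) * norm (Im_vec Z))"
  for Z :: "complex ^ 'm"
  unfolding lie_sq_def gram_perp real_sqrt_abs unfolding norm_sq_Re_Im[of Z] by simp

lemma lie_sq_ge: "(norm Z)\<^sup>2 \<le> lie_sq Z" for Z :: "complex ^ 'm"
  unfolding lie_sq_def gram_perp by simp

lemma lie_sq_le: "lie_sq Z \<le> 2 * (norm Z)\<^sup>2" for Z :: "complex ^ 'm"
proof -
  have "sqrt (((norm Z)\<^sup>2)\<^sup>2 - (cmod (csquare Z))\<^sup>2) \<le> sqrt (((norm Z)\<^sup>2)\<^sup>2)"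
    by (rule real_sqrt_le_mono) simp
  then show ?thesis unfolding lie_sq_def real_sqrt_abs by simp
qed

lemma lie_sq_pos: "Z \<noteq> 0 \<Longrightarrow> 0 < lie_sq Z" for Z :: "complex ^ 'm"
  using lie_sq_ge[of Z] by (metis less_le_trans zero_less_norm_iff zero_less_power)

lemma lie_sq_scale: "lie_sq (c *s Z) = (cmod c)\<^sup>2 * lie_sq Z" for Z :: "complex ^ 'm"
proof -
  have "((norm (c *s Z))\<^sup>2)\<^sup>2 - (cmod (csquare (c *s Z)))\<^sup>2
      = ((cmod c)\<^sup>2)\<^sup>2 * (((norm Z)\<^sup>2)\<^sup>2 - (cmod (csquare Z))\<^sup>2)"
    by (simp add: norm_scale csquare_scale norm_mult norm_power power_mult_distrib algebra_simps)
  then show ?thesis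
    unfolding lie_sq_def
    by (simp only: real_sqrt_mult real_sqrt_abs abs_power2 norm_scale power_mult_distrib distrib_left)
qed

lemma lie_sq_cvec: "lie_sq (cvec X) = (norm (cvec X))\<^sup>2"
  by (simp add: lie_sq_eq norm_sq_Re_Im[of "cvec X"])

lemma continuous_on_lie_sq: "continuous_on S (lie_sq :: complex ^ 'm \<Rightarrow> real)"
  unfolding lie_sq_def[abs_def] csquare_def by (intro continuous_intros)

text \<open>The bilinear product of $Z$ with $e - if$.  If $e$ and $f$ are orthonormal, $e - if$ is a null
  vector of the quadratic form $Z^2$.\<close>

definition isotropic_form :: "real ^ 'm \<Rightarrow> real ^ 'm \<Rightarrow> complex ^ 'm \<Rightarrow> complex" where
  "isotropic_form e f Z = (\<Sum>i\<in>UNIV. Z $ i * Complex (e $ i) (- (f $ i)))"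

lemma isotropic_form_add: "isotropic_form e f (Z + W) = isotropic_form e f Z + isotropic_form e f W"
  and isotropic_form_scale: "isotropic_form e f (c *s Z) = c * isotropic_form e f Z"
  by (simp_all add: isotropic_form_def algebra_simps sum.distrib sum_distrib_left)

lemma isotropic_form_Re_Im:
  "isotropic_form e f Z = Complex (Re_vec Z \<bullet> e + Im_vec Z \<bullet> f) (Im_vec Z \<bullet> e - Re_vec Z \<bullet> f)"
  by (simp add: isotropic_form_def complex_eq_iff inner_vec_def Re_vec_def Im_vec_def
      sum.distrib sum_subtractf algebra_simps)

lemma bessel_two:
  fixes C e f :: "'a::real_inner"
  assumes "e \<bullet> f = 0" "norm e \<le> 1" "norm f \<le> 1"
  shows "(C \<bullet> e)\<^sup>2 + (C \<bullet> f)\<^sup>2 \<le> (norm C)\<^sup>2"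
proof -
  let ?p = "C \<bullet> e" and ?q = "C \<bullet> f"
  have ee: "e \<bullet> e \<le> 1" "f \<bullet> f \<le> 1" using assms(2,3) by (simp_all add: norm_le_square norm_eq_sqrt_inner)
  have "0 \<le> (C - ?p *\<^sub>R e - ?q *\<^sub>R f) \<bullet> (C - ?p *\<^sub>R e - ?q *\<^sub>R f)" by simp
  also have "\<dots> = C \<bullet> C - 2 * ?p\<^sup>2 - 2 * ?q\<^sup>2 + ?p\<^sup>2 * (e \<bullet> e) + ?q\<^sup>2 * (f \<bullet> f)"
    using assms(1)
    by (simp add: inner_diff_left inner_diff_right inner_commute power2_eq_square algebra_simps)
  also have "\<dots> \<le> C \<bullet> C - 2 * ?p\<^sup>2 - 2 * ?q\<^sup>2 + ?p\<^sup>2 * 1 + ?q\<^sup>2 * 1"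
    by (intro add_mono mult_left_mono ee) auto
  finally show ?thesis by (simp add: power2_norm_eq_inner)
qed

text \<open>The cross term in $|Z \cdot (e - if)|^2$ is the determinant of the matrix of inner products of
  ${\rm Re}\,Z, {\rm Im}\,Z$ with $e, f$.  It does not change when ${\rm Re}\,Z$ is replaced by its component
  orthogonal to ${\rm Im}\,Z$, and then Cauchy-Schwarz bounds it by the product of the two norms.\<close>

lemma isotropic_form_le:
  assumes ef: "e \<bullet> f = 0" "norm e \<le> 1" "norm f \<le> 1"
  shows "(cmod (isotropic_form e f Z))\<^sup>2 \<le> lie_sq Z"
proof -
  let ?X = "Re_vec Z" and ?Y = "Im_vec Z"
  let ?P = "perp ?X ?Y"
  define s where "s = (?X \<bullet> ?Y) / (?Y \<bullet> ?Y)"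
  let ?d = "(?P \<bullet> e) * (?Y \<bullet> f) - (?Y \<bullet> e) * (?P \<bullet> f)"
  have "?d\<^sup>2 \<le> ((?P \<bullet> e)\<^sup>2 + (?P \<bullet> f)\<^sup>2) * ((?Y \<bullet> e)\<^sup>2 + (?Y \<bullet> f)\<^sup>2)"
    using zero_le_power2[of "(?P \<bullet> e) * (?Y \<bullet> e) + (?P \<bullet> f) * (?Y \<bullet> f)"]
    by (simp add: power2_eq_square algebra_simps)
  also have "\<dots> \<le> (norm ?P)\<^sup>2 * (norm ?Y)\<^sup>2"
    by (intro mult_mono bessel_two ef) auto
  finally have d: "?d \<le> norm ?P * norm ?Y"
    by (metis power2_le_imp_le power_mult_distrib mult_nonneg_nonneg norm_ge_zero)
  have X: "?X \<bullet> v = ?P \<bullet> v + s * (?Y \<bullet> v)" for v by (simp add: perp_def s_def inner_diff_left)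
  have "(cmod (isotropic_form e f Z))\<^sup>2
      = ((?X \<bullet> e)\<^sup>2 + (?X \<bullet> f)\<^sup>2) + ((?Y \<bullet> e)\<^sup>2 + (?Y \<bullet> f)\<^sup>2)
        + 2 * ((?X \<bullet> e) * (?Y \<bullet> f) - (?Y \<bullet> e) * (?X \<bullet> f))"
    unfolding isotropic_form_Re_Im cmod_power2 complex.sel
    by (simp add: power2_eq_square algebra_simps)
  also have "(?X \<bullet> e) * (?Y \<bullet> f) - (?Y \<bullet> e) * (?X \<bullet> f) = ?d"
    unfolding X by (simp add: algebra_simps)
  also have "((?X \<bullet> e)\<^sup>2 + (?X \<bullet> f)\<^sup>2) + ((?Y \<bullet> e)\<^sup>2 + (?Y \<bullet> f)\<^sup>2) + 2 * ?d
      \<le> (norm ?X)\<^sup>2 + (norm ?Y)\<^sup>2 + 2 * (norm ?P * norm ?Y)"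
    by (intro add_mono mult_left_mono bessel_two ef d) auto
  finally show ?thesis by (simp add: lie_sq_eq)
qed

text \<open>The maximum is attained when $e$ and $f$ point along the orthogonalised real part and along the
  imaginary part.  Where one of these vanishes, its \<^const>\<open>sgn\<close> is $0$; this is why $e$ and $f$ are only
  required to have length at most $1$.\<close>

lemma isotropic_form_attains:
  fixes Z :: "complex ^ 'm"
  obtains e f :: "real ^ 'm"
  where "e \<bullet> f = 0" "norm e \<le> 1" "norm f \<le> 1" "(cmod (isotropic_form e f Z))\<^sup>2 = lie_sq Z"
proof -
  let ?X = "Re_vec Z" and ?Y = "Im_vec Z"
  let ?P = "perp ?X ?Y"
  define s where "s = (?X \<bullet> ?Y) / (?Y \<bullet> ?Y)"
  let ?e = "sgn ?P" and ?f = "sgn ?Y"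
  have self: "v \<bullet> sgn v = norm v" for v :: "real ^ 'm"
    by (cases "v = 0")
      (simp_all add: sgn_div_norm power2_norm_eq_inner[symmetric] power2_eq_square)
  have PY: "?P \<bullet> ?f = 0" "?Y \<bullet> ?e = 0"
    using inner_perp[of ?X ?Y] by (simp_all add: sgn_div_norm inner_commute)
  have X: "?X \<bullet> v = ?P \<bullet> v + s * (?Y \<bullet> v)" for v by (simp add: perp_def s_def inner_diff_left)
  have "(cmod (isotropic_form ?e ?f Z))\<^sup>2 = (norm ?P + norm ?Y)\<^sup>2 + (s * norm ?Y)\<^sup>2"
    unfolding isotropic_form_Re_Im cmod_power2 complex.sel X PY self by simp
  also have "\<dots> = lie_sq Z"
    unfolding lie_sq_eq norm_perp[of ?X ?Y] s_def[symmetric]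
    by (simp add: power2_eq_square algebra_simps)
  finally have "(cmod (isotropic_form ?e ?f Z))\<^sup>2 = lie_sq Z" .
  moreover have "?e \<bullet> ?f = 0" using inner_perp[of ?X ?Y] by (simp add: sgn_div_norm)
  moreover have "norm (sgn v) \<le> 1" for v :: "real ^ 'm" by (simp add: norm_sgn)
  ultimately show ?thesis using that by blast
qed

section \<open>Homogeneous coordinates and affine charts\<close>

lemma continuous_on_point: "continuous_on (- {0}) (point :: complex ^ 'm \<Rightarrow> 'm::finite cproj)"
proof -
  have "\<exists>A. open A \<and> A \<inter> - {0} = point -` U \<inter> - {0}" if "open U" for U :: "'m cproj set"
    using that unfolding open_cproj_def
    by (intro exI[of _ "{v. v \<noteq> 0 \<and> point v \<in> U}"]) auto
  then show ?thesis by (simp add: continuous_on_open_invariant)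
qed

lemma point_scale: "c \<noteq> 0 \<Longrightarrow> v \<noteq> 0 \<Longrightarrow> point (c *s v) = point v"
  using point_eq_iff[of v "c *s v"] by auto

lemma cproj_cases:
  fixes p :: "'m::finite cproj"
  obtains v where "v \<noteq> 0" "p = point v"
proof -
  obtain v where "v \<noteq> 0" "Rep_cproj p = vec.span {v}" using Rep_cproj[of p] by auto
  moreover from this have "p = point v" by (metis Rep_cproj_inverse point_def)
  ultimately show ?thesis using that by blast
qed

lemma real_points_eq: "real_points = {point (cvec x) |x. x \<noteq> 0}"
  by (simp add: real_points_def cvec_def)

lemma point_cvec_in_real_points: "x \<noteq> 0 \<Longrightarrow> point (cvec x) \<in> real_points"
  by (auto simp: real_points_eq)

lemma cvec_eq_0_iff: "cvec x = 0 \<longleftrightarrow> x = 0"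
  by (simp add: cvec_def vec_eq_iff)

text \<open>The vector with $j$-th coordinate $c$ whose other coordinates are those of $z$: for $c = 1$ the
  representative of a point of the $j$-th affine chart, for $c = 0$ a direction in that chart.\<close>

definition chart_vec :: "'n option \<Rightarrow> complex \<Rightarrow> complex ^ 'n \<Rightarrow> complex ^ 'n::finite option" where
  "chart_vec j c z = (\<chi> i. hom_coords c z $ Transposition.transpose None j i)"

lemma affine_chart_eq: "affine_chart j z = point (chart_vec j 1 z)"
  by (simp add: affine_chart_def chart_vec_def)

lemma chart_vec_None: "chart_vec None c z = hom_coords c z"
  by (simp add: chart_vec_def)

lemma chart_vec_nth [simp]: "chart_vec j c z $ j = c"
  by (simp add: chart_vec_def hom_coords_def)

lemma chart_vec_nonzero: "c \<noteq> 0 \<Longrightarrow> chart_vec j c z \<noteq> 0"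
  by (metis chart_vec_nth zero_index)

lemma chart_vec_affine: "chart_vec j c (z + s *s w) = chart_vec j c z + s *s chart_vec j 0 w"
  by (auto simp: chart_vec_def hom_coords_def vec_eq_iff split: option.splits)

lemma chart_vec_surj:
  obtains z where "V = chart_vec j (V $ j) z"
proof -
  have "V = chart_vec j (V $ j) (\<chi> k. V $ Transposition.transpose None j (Some k))"
    unfolding chart_vec_def hom_coords_def vec_eq_iff
    by (auto split: option.splits simp: Transposition.transpose_def split: if_splits)
  then show ?thesis by (rule that)
qed

lemma sum_option: "(\<Sum>i\<in>UNIV. f i) = f None + (\<Sum>k\<in>UNIV. f (Some k))"
  for f :: "'n::finite option \<Rightarrow> 'a::comm_monoid_add"
  by (simp add: UNIV_option_conv sum.reindex)

lemma norm_chart_vec: "(norm (chart_vec j c z))\<^sup>2 = (cmod c)\<^sup>2 + (norm z)\<^sup>2"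
proof -
  have n: "(norm v)\<^sup>2 = (\<Sum>i\<in>UNIV. (cmod (v $ i))\<^sup>2)" for v :: "complex ^ 'k"
    by (simp add: norm_vec_def L2_set_def sum_nonneg)
  have "(norm (chart_vec j c z))\<^sup>2
      = (\<Sum>i\<in>UNIV. (cmod (hom_coords c z $ Transposition.transpose None j i))\<^sup>2)"
    by (simp add: n chart_vec_def)
  also have "\<dots> = (\<Sum>i\<in>UNIV. (cmod (hom_coords c z $ i))\<^sup>2)"
    by (rule sum.reindex_bij_betw[where g = "\<lambda>i. (cmod (hom_coords c z $ i))\<^sup>2"]) simp
  also have "\<dots> = (cmod c)\<^sup>2 + (norm z)\<^sup>2"
    by (simp add: sum_option n hom_coords_def)
  finally show ?thesis .
qed

lemma csquare_hom_coords: "csquare (hom_coords c z) = c\<^sup>2 + csquare z"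
  by (simp add: csquare_def sum_option hom_coords_def)

text \<open>This turns a function $\phi + u_0$ in a chart into $\phi + \log|Z|$ in homogeneous coordinates.\<close>

lemma u0_eq_ln_norm: "u0 z = ln (norm (chart_vec j 1 z))"
proof -
  have "u0 z = 1/2 * ln ((norm (chart_vec j 1 z))\<^sup>2)" by (simp add: u0_def norm_chart_vec)
  then show ?thesis using chart_vec_nonzero[of 1 j z] by (simp add: ln_realpow)
qed

lemma continuous_on_chart_vec [continuous_intros]:
  "continuous_on S f \<Longrightarrow> continuous_on S (\<lambda>x. chart_vec j c (f x))"
proof -
  assume f: "continuous_on S f"
  have "continuous_on S (\<lambda>x. hom_coords c (f x) $ i)" for i
    by (cases i) (auto simp: hom_coords_def intro!: continuous_intros f)
  then show ?thesis unfolding chart_vec_def by (intro continuous_on_vec_lambda)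
qed

section \<open>Finiteness of the Fubini-Study volume\<close>

text \<open>On the shell $2^{k-1} < |z| \le 2^k$ in $\mathbb{C}^n$ the integrand is at most a constant times
  $4^{-k(n+1)}$, and the volume of the shell is at most a constant times $4^{kn}$;
  so the shells contribute a convergent geometric series.\<close>

lemma finite_fubini_study_volume:
  "(\<integral>\<^sup>+ z. ennreal (c / (d * (1 + (norm z)\<^sup>2) ^ (CARD('n) + 1))) \<partial>(lborel :: (complex ^ 'n) measure)) < \<infinity>"
  if "0 \<le> c" "0 < d"
proof -
  let ?n = "CARD('n)"
  define C where "C = c / d * 4 ^ (?n + 1)"
  define a where "a k = C / 4 ^ (k * (?n + 1))" for k :: nat
  have C: "0 \<le> C" using that by (simp add: C_def)
  have a: "0 \<le> a k" for k using C by (simp add: a_def)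
  have pointwise: "ennreal (c / (d * (1 + (norm z)\<^sup>2) ^ (?n + 1)))
      \<le> (\<Sum>k. ennreal (a k) * indicator (cball 0 (2 ^ k)) z)" for z :: "complex ^ 'n"
  proof -
    define k where "k = (LEAST k. norm z \<le> 2 ^ k)"
    obtain k0 :: nat where "norm z \<le> 2 ^ k0"
      using real_arch_pow[of 2 "norm z"] by (auto intro: less_imp_le)
    then have k: "norm z \<le> 2 ^ k" unfolding k_def by (rule LeastI)
    have "4 ^ k / 4 \<le> 1 + (norm z)\<^sup>2"
    proof (cases k)
      case (Suc m)
      then have "\<not> norm z \<le> 2 ^ m" using not_less_Least[of m "\<lambda>k. norm z \<le> 2 ^ k"] by (simp add: k_def)
      then have "(2 ^ m)\<^sup>2 \<le> (norm z)\<^sup>2" by (intro power_mono) simp_all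
      moreover have "(2 ^ m)\<^sup>2 = (4 :: real) ^ m"
        using power_mult[of "2::real" 2 m] power_mult[of "2::real" m 2] by (simp add: mult.commute)
      ultimately show ?thesis by (simp add: Suc)
    qed (simp add: add_increasing2)
    then have "(4 ^ k / 4) ^ (?n + 1) \<le> (1 + (norm z)\<^sup>2) ^ (?n + 1)" by (intro power_mono) auto
    then have "c / d / (1 + (norm z)\<^sup>2) ^ (?n + 1) \<le> c / d / (4 ^ k / 4) ^ (?n + 1)"
      using that by (intro divide_left_mono) (auto intro!: mult_pos_pos zero_less_power add_pos_nonneg)
    also have "\<dots> = a k" by (simp add: a_def C_def power_divide power_mult power_add)
    finally have "ennreal (c / (d * (1 + (norm z)\<^sup>2) ^ (?n + 1))) \<le> ennreal (a k)"
      by (intro ennreal_leI) (simp add: mult.assoc)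
    also have "\<dots> = ennreal (a k) * indicator (cball 0 (2 ^ k)) z" using k by simp
    also have "\<dots> \<le> (\<Sum>k. ennreal (a k) * indicator (cball 0 (2 ^ k)) z)"
    proof -
      define g where "g = (\<lambda>k. ennreal (a k) * indicator (cball 0 (2 ^ k)) z)"
      have "sum g {k} \<le> suminf g" by (rule sum_le_suminf) auto
      then have "g k \<le> suminf g" by simp
      then show ?thesis unfolding g_def .
    qed
    finally show ?thesis .
  qed
  define V where "V = unit_ball_vol (real (2 * ?n))"
  have V: "0 \<le> V" by (simp add: V_def)
  have "(\<integral>\<^sup>+ z. ennreal (c / (d * (1 + (norm z)\<^sup>2) ^ (?n + 1))) \<partial>(lborel :: (complex ^ 'n) measure))
      \<le> (\<integral>\<^sup>+ z. (\<Sum>k. ennreal (a k) * indicator (cball 0 (2 ^ k)) z) \<partial>(lborel :: (complex ^ 'n) measure))"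
    by (intro nn_integral_mono pointwise)
  also have "\<dots> = (\<Sum>k. \<integral>\<^sup>+ z. ennreal (a k) * indicator (cball 0 (2 ^ k)) z \<partial>(lborel :: (complex ^ 'n) measure))"
    by (intro nn_integral_suminf borel_measurable_times_ennreal borel_measurable_const
      borel_measurable_indicator) simp
  also have "\<dots> = (\<Sum>k. ennreal (C * V * (1 / 4) ^ k))"
  proof (rule suminf_cong)
    fix k :: nat
    have "(\<integral>\<^sup>+ z. ennreal (a k) * indicator (cball 0 (2 ^ k)) z \<partial>(lborel :: (complex ^ 'n) measure))
        = ennreal (a k) * ennreal (V * (2 ^ k) ^ (2 * ?n))"
      by (simp add: nn_integral_cmult_indicator emeasure_cball V_def mult.commute)
    also have "\<dots> = ennreal (a k * (V * (2 ^ k) ^ (2 * ?n)))" using a V by (simp add: ennreal_mult)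
    also have "(2 ^ k) ^ (2 * ?n) = (4 ^ (k * ?n) :: real)"
      using power_mult[of "2::real" 2 "k * ?n"] power_mult[of "2::real" k "2 * ?n"]
      by (simp add: mult.left_commute)
    also have "a k * (V * 4 ^ (k * ?n)) = C * V * (1 / 4) ^ k"
      by (simp add: a_def power_add power_divide)
    finally show "(\<integral>\<^sup>+ z. ennreal (a k) * indicator (cball 0 (2 ^ k)) z \<partial>(lborel :: (complex ^ 'n) measure))
      = ennreal (C * V * (1 / 4) ^ k)" .
  qed
  also have "\<dots> = ennreal (\<Sum>k. C * V * (1 / 4) ^ k)"
    using C V by (intro suminf_ennreal2 summable_mult summable_geometric) auto
  also have "\<dots> < \<infinity>" by simp
  finally show ?thesis .
qed

section \<open>Integrals over circles\<close>

lemma circle_integrable: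
  fixes k :: "real \<Rightarrow> real"
  assumes "continuous_on UNIV k"
  shows "integrable (uniform_measure lborel {0..2 * pi}) k"
    and "integral\<^sup>L (uniform_measure lborel {0..2 * pi}) k = integral {0..2 * pi} k / (2 * pi)"
proof -
  let ?I = "{0..2 * pi} :: real set"
  have M: "uniform_measure lborel ?I = density lborel (\<lambda>t. ennreal (indicator ?I t / (2 * pi)))"
    unfolding uniform_measure_def
    by (rule arg_cong[where f = "density lborel"])
      (auto simp: fun_eq_iff divide_ennreal indicator_def simp del: ennreal_1 simp flip: ennreal_1)
  have k: "k \<in> borel_measurable lborel" using assms by (simp add: borel_measurable_continuous_onI)
  have set_int: "set_integrable lborel ?I k"
    by (rule borel_integrable_atLeastAtMost') (rule continuous_on_subset[OF assms], simp)
  then have "integrable lborel (\<lambda>t. (indicator ?I t *\<^sub>R k t) / (2 * pi))"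
    unfolding set_integrable_def by (rule integrable_divide_zero)
  then show "integrable (uniform_measure lborel ?I) k"
    unfolding M by (subst integrable_density) (use k in auto)
  have "integral\<^sup>L (uniform_measure lborel ?I) k = (LINT t|lborel. (indicator ?I t *\<^sub>R k t) / (2 * pi))"
    unfolding M by (subst integral_density) (use k in auto)
  also have "\<dots> = (LINT t:?I|lborel. k t) / (2 * pi)" by (simp add: set_lebesgue_integral_def)
  also have "(LINT t:?I|lborel. k t) = integral ?I k" by (rule set_borel_integral_eq_integral(2)[OF set_int])
  finally show "integral\<^sup>L (uniform_measure lborel ?I) k = integral ?I k / (2 * pi)" .
qed

lemma ereal_integral_ereal:
  assumes "integrable M k"
  shows "ereal_integral M (\<lambda>t. ereal (k t)) = ereal (integral\<^sup>L M k)"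
proof -
  have fin: "(\<integral>\<^sup>+ t. ennreal (k t) \<partial>M) < \<infinity>" "(\<integral>\<^sup>+ t. ennreal (- k t) \<partial>M) < \<infinity>"
    using assms integrable_minus[OF assms] by (auto simp: real_integrable_def top.not_eq_extremum)
  obtain p where p: "(\<integral>\<^sup>+ t. ennreal (k t) \<partial>M) = ennreal p" "0 \<le> p"
    using fin(1) by (cases "\<integral>\<^sup>+ t. ennreal (k t) \<partial>M" rule: ennreal_cases) auto
  obtain q where q: "(\<integral>\<^sup>+ t. ennreal (- k t) \<partial>M) = ennreal q" "0 \<le> q"
    using fin(2) by (cases "\<integral>\<^sup>+ t. ennreal (- k t) \<partial>M" rule: ennreal_cases) auto
  show ?thesis
    by (simp add: ereal_integral_def real_lebesgue_integral_def[OF assms] p q e2ennreal_ereal enn2ereal_ennreal)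
qed

lemma ereal_integral_mono:
  assumes "\<And>t. u t \<le> v t"
  shows "ereal_integral M u \<le> ereal_integral M v"
  unfolding ereal_integral_def
  by (intro ereal_minus_mono) (auto simp: less_eq_ennreal.rep_eq[symmetric] intro!: nn_integral_mono e2ennreal_mono assms)

section \<open>The extremal competitor\<close>

text \<open>The function $\log L(Z) - \log|Z|$ on projective space.  The quotient is invariant under scaling of
  $Z$, so any representative may be chosen.\<close>

definition lie_fun :: "'m::finite cproj \<Rightarrow> real" where
  "lie_fun p = (let v = (SOME v. v \<noteq> 0 \<and> p = point v) in 1/2 * ln (lie_sq v / (norm v)\<^sup>2))"

lemma lie_fun_point:
  assumes "v \<noteq> 0"
  shows "lie_fun (point v) = 1/2 * ln (lie_sq v / (norm v)\<^sup>2)"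
proof -
  define w where "w = (SOME w. w \<noteq> 0 \<and> point v = point w)"
  have "w \<noteq> 0 \<and> point v = point w" unfolding w_def by (rule someI[of _ v]) (simp add: assms)
  then obtain c where "c \<noteq> 0" "w = c *s v" using point_eq_iff[of v w] assms by blast
  then have "lie_sq w / (norm w)\<^sup>2 = lie_sq v / (norm v)\<^sup>2"
    by (simp add: lie_sq_scale norm_scale power_mult_distrib)
  then show ?thesis unfolding lie_fun_def w_def[symmetric] Let_def by simp
qed

lemma lie_fun_point':
  assumes "v \<noteq> 0"
  shows "lie_fun (point v) = ln (sqrt (lie_sq v)) - ln (norm v)"
  using assms lie_sq_pos[OF assms] by (simp add: lie_fun_point ln_div ln_realpow ln_sqrt)

lemma lie_fun_bounds: "0 \<le> lie_fun p" "lie_fun p \<le> 1"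
proof -
  obtain v where v: "v \<noteq> 0" "p = point v" by (rule cproj_cases)
  have r: "1 \<le> lie_sq v / (norm v)\<^sup>2" "lie_sq v / (norm v)\<^sup>2 \<le> 2"
    using v(1) lie_sq_ge[of v] lie_sq_le[of v] by (simp_all add: divide_simps)
  then show "0 \<le> lie_fun p" by (simp add: v lie_fun_point)
  have "ln (lie_sq v / (norm v)\<^sup>2) \<le> lie_sq v / (norm v)\<^sup>2 - 1" using r by (intro ln_le_minus_one) simp
  then show "lie_fun p \<le> 1" using r by (simp add: v lie_fun_point)
qed

text \<open>By the definition of the quotient topology, continuity is checked on the nonzero vectors.\<close>

lemma continuous_on_lie_fun: "continuous_on UNIV (lie_fun :: 'm::finite cproj \<Rightarrow> real)"
proof -
  have "open (lie_fun -` U :: 'm cproj set)" if "open U" for U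
  proof -
    let ?g = "\<lambda>v :: complex ^ 'm. 1/2 * ln (lie_sq v / (norm v)\<^sup>2)"
    have "continuous_on (- {0}) ?g"
    proof (intro continuous_intros continuous_on_lie_sq ballI)
      show "lie_sq v / (norm v)\<^sup>2 \<noteq> 0" if "v \<in> - {0}" for v :: "complex ^ 'm"
        using lie_sq_pos[of v] that by simp
    qed auto
    then have "open (- {0} \<inter> ?g -` U)"
      using that by (intro continuous_open_preimage) auto
    also have "- {0} \<inter> ?g -` U = {v. v \<noteq> 0 \<and> point v \<in> lie_fun -` U}"
      by (auto simp: lie_fun_point)
    finally show ?thesis unfolding open_cproj_def .
  qed
  then show ?thesis by (simp add: continuous_on_open_vimage)
qed

text \<open>At the centre $P$ the Lie norm equals the modulus of one isotropic form, and on the whole circle it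
  is at least that modulus, so Jensen's inequality applies to the affine function that the form
  induces on the disc.\<close>

lemma ln_lie_submean:
  fixes P W :: "complex ^ 'm"
  assumes one: "\<And>t. 1 \<le> lie_sq (P + cis t *s W)" and P: "1 \<le> lie_sq P"
  shows "ereal (ln (sqrt (lie_sq P)))
    \<le> ereal_integral (uniform_measure lborel {0..2 * pi}) (\<lambda>t. ereal (ln (sqrt (lie_sq (P + cis t *s W)))))"
proof -
  let ?f = "\<lambda>t. ln (sqrt (lie_sq (P + cis t *s W)))"
  have pos: "0 < lie_sq (P + cis t *s W)" for t using one[of t] by linarith
  have smult: "c *s W = (\<chi> i. c * W $ i)" for c :: complex by (simp add: vec_eq_iff)
  have "continuous_on UNIV (\<lambda>t. lie_sq (P + cis t *s W))"
    unfolding smult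
    by (rule continuous_on_compose2[OF continuous_on_lie_sq[of UNIV]])
      (auto intro!: continuous_intros continuous_on_vec_lambda)
  then have cont: "continuous_on UNIV ?f"
    by (intro continuous_intros) (use pos in \<open>auto simp: less_imp_neq[symmetric]\<close>)
  obtain e f :: "real ^ 'm" where ef: "e \<bullet> f = 0" "norm e \<le> 1" "norm f \<le> 1"
      "(cmod (isotropic_form e f P))\<^sup>2 = lie_sq P"
    by (rule isotropic_form_attains)
  define \<alpha> \<beta> where "\<alpha> = isotropic_form e f P" and "\<beta> = isotropic_form e f W"
  have \<alpha>: "sqrt (lie_sq P) = cmod \<alpha>" by (simp add: ef(4)[symmetric] \<alpha>_def)
  have "2 * pi * ln (cmod \<alpha>) \<le> integral {0..2 * pi} ?f"
  proof (rule ln_norm_le_integral)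
    show "continuous_on {0..2 * pi} ?f" using cont by (rule continuous_on_subset) simp
    show "0 \<le> ?f t" for t using one[of t] by simp
    show "\<alpha> \<noteq> 0" using P \<alpha> by auto
    fix t
    have "\<alpha> + \<beta> * cis t = isotropic_form e f (P + cis t *s W)"
      by (simp add: \<alpha>_def \<beta>_def isotropic_form_add isotropic_form_scale mult.commute)
    then have "(cmod (\<alpha> + \<beta> * cis t))\<^sup>2 \<le> lie_sq (P + cis t *s W)"
      using isotropic_form_le[OF ef(1-3)] by simp
    then show "cmod (\<alpha> + \<beta> * cis t) \<le> exp (?f t)" using pos[of t] by (simp add: real_le_rsqrt)
  qed
  then have "ln (sqrt (lie_sq P)) \<le> integral {0..2 * pi} ?f / (2 * pi)"
    by (simp add: \<alpha> field_simps)
  also have "ereal \<dots> = ereal_integral (uniform_measure lborel {0..2 * pi}) (\<lambda>t. ereal (?f t))"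
    using circle_integrable[OF cont] by (simp add: ereal_integral_ereal)
  finally show ?thesis by simp
qed

text \<open>Continuity gives measurability and semicontinuity, and boundedness together with the finite volume
  gives integrability.  Adding the potential in the $j$-th chart leaves $\log L$ at the representative
  with $j$-th coordinate $1$, so the sub-mean value inequality is the one for $\log L$.\<close>

lemma lie_fun_in_PSH_omega:
  "(\<lambda>p. ereal (lie_fun p)) \<in> (PSH_omega :: ('n::finite option cproj \<Rightarrow> ereal) set)"
proof -
  let ?\<phi> = "\<lambda>p :: 'n option cproj. ereal (lie_fun p)"
  have chart: "?\<phi> (affine_chart j z) + ereal (u0 z) = ereal (ln (sqrt (lie_sq (chart_vec j 1 z))))" for j z
    by (simp add: affine_chart_eq u0_eq_ln_norm[of z j] lie_fun_point' chart_vec_nonzero)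
  \<comment> \<open>One coordinate of the vector is $1$, so its norm is at least $1$ and the logarithm is nonnegative.\<close>
  have ge1: "1 \<le> lie_sq (chart_vec j 1 z)" for j :: "'n option" and z
    using lie_sq_ge[of "chart_vec j 1 z"] norm_chart_vec[of j 1 z] by (simp add: order_trans[rotated])
  have "?\<phi> \<in> borel_measurable borel"
    by (intro borel_measurable_ereal borel_measurable_continuous_onI continuous_on_lie_fun)
  moreover have "(\<integral>\<^sup>+ p. e2ennreal \<bar>?\<phi> p\<bar> \<partial>omega_volume) < \<infinity>"
  proof -
    have "continuous_on UNIV (\<lambda>z :: complex ^ 'n. point (chart_vec None 1 z))"
      by (rule continuous_on_compose2[OF continuous_on_point])
        (auto intro!: continuous_intros simp: chart_vec_nonzero)
    then have meas: "(\<lambda>z :: complex ^ 'n. point (hom_coords 1 z)) \<in> borel_measurable borel"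
      by (intro borel_measurable_continuous_onI) (simp add: chart_vec_None)
    have "(\<integral>\<^sup>+ p. e2ennreal \<bar>?\<phi> p\<bar> \<partial>omega_volume) \<le> (\<integral>\<^sup>+ p. 1 \<partial>(omega_volume :: 'n option cproj measure))"
    proof (rule nn_integral_mono)
      fix p :: "'n option cproj"
      have "\<bar>?\<phi> p\<bar> = ereal (lie_fun p)" using lie_fun_bounds(1)[of p] by simp
      then show "e2ennreal \<bar>?\<phi> p\<bar> \<le> 1" using lie_fun_bounds(2)[of p] by (simp add: e2ennreal_ereal ennreal_le_1)
    qed
    also have "\<dots> = (\<integral>\<^sup>+ z. ennreal (fact CARD('n) / (pi ^ CARD('n) * (1 + (norm z)\<^sup>2) ^ (CARD('n) + 1)))
        \<partial>(lborel :: (complex ^ 'n) measure))"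
    proof -
      have "(\<lambda>z. ennreal (fact CARD('n) / (pi ^ CARD('n) * (1 + (norm z)\<^sup>2) ^ (CARD('n) + 1))))
          \<in> borel_measurable (lborel :: (complex ^ 'n) measure)"
        by measurable
      with meas show ?thesis
        unfolding omega_volume_def
        by (subst nn_integral_distr) (simp_all add: nn_integral_density del: nn_integral_const)
    qed
    also have "\<dots> < \<infinity>" by (rule finite_fubini_study_volume) simp_all
    finally show ?thesis .
  qed
  moreover have "usc_on UNIV ?\<phi>"
  proof -
    have "open {p :: 'n option cproj. ereal (lie_fun p) < c}" for c
    proof -
      have "open ((\<lambda>p :: 'n option cproj. ereal (lie_fun p)) -` {..<c})"
        by (intro open_vimage open_lessThan continuous_intros continuous_on_lie_fun)
      then show ?thesis by (simp add: vimage_def)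
    qed
    then show ?thesis by (simp add: usc_on_def)
  qed
  moreover have "plurisubharmonic_on UNIV (\<lambda>z. ?\<phi> (affine_chart j z) + ereal (u0 z))" for j
    unfolding chart plurisubharmonic_on_def
  proof (intro conjI ballI allI impI)
    have cont: "continuous_on UNIV (\<lambda>z. ereal (ln (sqrt (lie_sq (chart_vec j 1 z)))))"
      using ge1[of j]
      by (intro continuous_intros continuous_on_compose2[OF continuous_on_lie_sq[of UNIV]])
        (auto simp: less_imp_neq[symmetric, OF less_le_trans[OF zero_less_one]])
    have "open {z. ereal (ln (sqrt (lie_sq (chart_vec j 1 z)))) < c}" for c
      using open_vimage[OF open_lessThan[of c] cont] by (simp add: vimage_def)
    then show "usc_on UNIV (\<lambda>z. ereal (ln (sqrt (lie_sq (chart_vec j 1 z)))))" by (simp add: usc_on_def)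
    fix a b :: "complex ^ 'n"
    show "ereal (ln (sqrt (lie_sq (chart_vec j 1 a))))
        \<le> ereal_integral (uniform_measure lborel {0..2 * pi})
            (\<lambda>t. ereal (ln (sqrt (lie_sq (chart_vec j 1 (a + cis t *s b))))))"
      unfolding chart_vec_affine
      by (rule ln_lie_submean) (use ge1[of j] in \<open>simp_all flip: chart_vec_affine\<close>)
  qed simp_all
  ultimately show ?thesis by (simp add: PSH_omega_def)
qed

section \<open>Upper semicontinuous functions\<close>

lemma usc_on_compose:
  assumes "usc_on T u" "continuous_on S f" "f ` S \<subseteq> T"
  shows "usc_on S (\<lambda>x. u (f x))"
  unfolding usc_on_def
proof
  fix c
  have "openin (top_of_set S) (S \<inter> f -` {y \<in> T. u y < c})"
    using assms by (intro continuous_openin_preimage[of S f T]) (auto simp: usc_on_def)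
  also have "S \<inter> f -` {y \<in> T. u y < c} = {x \<in> S. u (f x) < c}" using assms(3) by auto
  finally show "openin (top_of_set S) {x \<in> S. u (f x) < c}" .
qed

lemma usc_on_add_continuous:
  fixes g :: "'a::topological_space \<Rightarrow> real"
  assumes u: "usc_on S u" and g: "continuous_on S g"
  shows "usc_on S (\<lambda>x. u x + ereal (g x))"
  unfolding usc_on_def
proof
  fix c
  have eq: "{x \<in> S. u x + ereal (g x) < c}
      = (\<Union>d. {x \<in> S. u x < ereal d} \<inter> (S \<inter> (\<lambda>x. ereal (d + g x)) -` {..<c}))"
  proof (intro set_eqI iffI)
    fix x assume x: "x \<in> {x \<in> S. u x + ereal (g x) < c}"
    then have "u x < c - ereal (g x)" by (simp add: ereal_less_minus)
    then obtain d where d: "u x < ereal d" "ereal d < c - ereal (g x)" using ereal_dense2 by blast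
    then have "ereal (d + g x) < c" by (simp add: ereal_less_minus)
    with x d show "x \<in> (\<Union>d. {x \<in> S. u x < ereal d} \<inter> (S \<inter> (\<lambda>x. ereal (d + g x)) -` {..<c}))"
      by auto
  next
    fix x assume "x \<in> (\<Union>d. {x \<in> S. u x < ereal d} \<inter> (S \<inter> (\<lambda>x. ereal (d + g x)) -` {..<c}))"
    then obtain d where d: "x \<in> S" "u x < ereal d" "ereal (d + g x) < c" by auto
    have "u x + ereal (g x) \<le> ereal (d + g x)"
      using add_right_mono[OF less_imp_le[OF d(2)], of "ereal (g x)"] by simp
    with d show "x \<in> {x \<in> S. u x + ereal (g x) < c}" by auto
  qed
  have "openin (top_of_set S) (S \<inter> (\<lambda>x. ereal (d + g x)) -` {..<c})" for d
    by (intro continuous_openin_preimage_gen continuous_intros g)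
  moreover have "openin (top_of_set S) {x \<in> S. u x < ereal d}" for d
    using u by (simp add: usc_on_def)
  ultimately show "openin (top_of_set S) {x \<in> S. u x + ereal (g x) < c}"
    unfolding eq by (blast intro: openin_Union openin_Int)
qed

text \<open>If the maximum were not attained, the sets where $u$ is less than one of its values would cover $K$.
  Compactness leaves finitely many values, and a point where the largest of these is taken lies in
  none of the sets.\<close>

lemma usc_on_attains_max:
  assumes K: "compact K" "K \<noteq> {}" and u: "usc_on K u"
  obtains x where "x \<in> K" "\<And>y. y \<in> K \<Longrightarrow> u y \<le> u x"
proof (rule ccontr)
  assume "\<not> thesis"
  with that have "\<forall>x\<in>K. \<exists>y\<in>K. u x < u y" by (meson not_le)
  then have cover: "K \<subseteq> \<Union> ((\<lambda>y. {x \<in> K. u x < u y}) ` K)" by blast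
  have "\<forall>c\<in>(\<lambda>y. {x \<in> K. u x < u y}) ` K. openin (top_of_set K) c"
    using u by (auto simp: usc_on_def)
  with cover K(1)[unfolded compact_eq_openin_cover, rule_format, of "(\<lambda>y. {x \<in> K. u x < u y}) ` K"]
  obtain D where D: "D \<subseteq> (\<lambda>y. {x \<in> K. u x < u y}) ` K" "finite D" "K \<subseteq> \<Union> D"
    by auto
  obtain F where "F \<subseteq> K" "finite F" "D = (\<lambda>y. {x \<in> K. u x < u y}) ` F"
    using finite_subset_image[OF D(2,1)] by blast
  with D(3) have F: "F \<subseteq> K" "finite F" "K \<subseteq> (\<Union>y\<in>F. {x \<in> K. u x < u y})" by simp_all
  have "F \<noteq> {}" using F K(2) by auto
  then have "Max (u ` F) \<in> u ` F" using F(2) by (intro Max_in) simp_all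
  then obtain y where y: "Max (u ` F) = u y" "y \<in> F" by (rule imageE)
  from y(2) F(1) have "y \<in> K" by (rule rev_subsetD)
  with F(3) have "\<exists>z\<in>F. u y < u z" by blast
  then obtain z where "z \<in> F" "u y < u z" by blast
  moreover have "u z \<le> Max (u ` F)" using F(2) \<open>z \<in> F\<close> by simp
  ultimately show False using y(1) by simp
qed

section \<open>The maximum principle in a half plane\<close>

text \<open>The sub-mean value inequality is assumed for $w + h$ with $h$ harmonic, where harmonicity is
  expressed by exact circle means.  Only the circles that touch the real axis are used.  If $w$ is
  positive somewhere, then by the boundary conditions its maximum over the half plane is attained on
  a compact set inside the half plane.  A point of that set with the largest imaginary part is the
  centre of a circle tangent to the real axis: $w$ is at most its maximum on the whole circle, and
  smaller on the upper half of it, contrary to the sub-mean value inequality.\<close>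

lemma half_plane_maximum_principle:
  fixes w :: "complex \<Rightarrow> ereal" and h :: "complex \<Rightarrow> real"
  defines "H \<equiv> {\<tau>. 0 \<le> Im \<tau>}"
  assumes usc_w: "usc_on H w" and less_top: "\<And>\<tau>. \<tau> \<in> H \<Longrightarrow> w \<tau> < \<infinity>"
    and w_real: "\<And>\<tau>. Im \<tau> = 0 \<Longrightarrow> w \<tau> \<le> 0"
    and w_infinity: "\<And>c. 0 < c \<Longrightarrow> \<exists>R. \<forall>\<tau>\<in>H. R \<le> cmod \<tau> \<longrightarrow> w \<tau> < ereal c"
    and cont_h: "\<And>\<tau>. 0 < Im \<tau> \<Longrightarrow> continuous_on UNIV (\<lambda>t. h (\<tau> + of_real (Im \<tau>) * cis t))"
    and mean_h: "\<And>\<tau>. 0 < Im \<tau> \<Longrightarrow>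
      ((\<lambda>t. h (\<tau> + of_real (Im \<tau>) * cis t)) has_integral 2 * pi * h \<tau>) {0..2 * pi}"
    and submean: "\<And>\<tau>. 0 < Im \<tau> \<Longrightarrow> w \<tau> + ereal (h \<tau>)
      \<le> ereal_integral (uniform_measure lborel {0..2 * pi})
          (\<lambda>t. w (\<tau> + of_real (Im \<tau>) * cis t) + ereal (h (\<tau> + of_real (Im \<tau>) * cis t)))"
    and \<tau>1: "\<tau>1 \<in> H"
  shows "w \<tau>1 \<le> 0"
proof (rule ccontr)
  assume "\<not> w \<tau>1 \<le> 0"
  then have "0 < w \<tau>1" by simp
  then obtain c where c: "0 < c" "ereal c < w \<tau>1" using ereal_dense2[of 0 "w \<tau>1"] by auto
  obtain R where R: "\<And>\<tau>. \<tau> \<in> H \<Longrightarrow> R \<le> cmod \<tau> \<Longrightarrow> w \<tau> < ereal c"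
    using w_infinity[OF c(1)] by blast
  define K where "K = H \<inter> cball 0 R"
  have "closed H" unfolding H_def by (intro closed_Collect_le continuous_intros)
  then have K: "compact K" unfolding K_def by (intro closed_Int_compact) auto
  have \<tau>1K: "\<tau>1 \<in> K"
    using R[of \<tau>1] less_asym[OF c(2)] \<tau>1 by (cases "cmod \<tau>1 \<le> R") (auto simp: K_def)
  have usc_K: "usc_on K w"
    using usc_on_compose[OF usc_w, of K "\<lambda>x. x"] by (auto simp: K_def)
  obtain \<tau>m where \<tau>m: "\<tau>m \<in> K" "\<And>\<tau>. \<tau> \<in> K \<Longrightarrow> w \<tau> \<le> w \<tau>m"
    using usc_on_attains_max[OF K _ usc_K] \<tau>1K by blast
  have cm: "ereal c < w \<tau>m" using c(2) \<tau>m(2)[OF \<tau>1K] by (rule less_le_trans)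
  have "w \<tau>m < \<infinity>" using less_top \<tau>m(1) by (simp add: K_def)
  with cm obtain m where m: "w \<tau>m = ereal m" by (cases "w \<tau>m") auto
  have far: "w \<tau> < ereal m" if "\<tau> \<in> H" "R \<le> cmod \<tau>" for \<tau>
    using R[OF that] cm unfolding m by (rule less_trans)
  have w_max: "w \<tau> \<le> ereal m" if "\<tau> \<in> H" for \<tau>
    using \<tau>m(2)[of \<tau>] far[OF that] that m by (cases "cmod \<tau> \<le> R") (auto simp: K_def)
  \<comment> \<open>The set where the maximum is attained.\<close>
  define A where "A = {\<tau> \<in> K. ereal m \<le> w \<tau>}"
  have "A = K - {\<tau> \<in> K. w \<tau> < ereal m}" by (auto simp: A_def not_less)
  moreover have "openin (top_of_set K) {\<tau> \<in> K. w \<tau> < ereal m}" using usc_K by (simp add: usc_on_def)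
  ultimately have "closedin (top_of_set K) A"
    by (metis closedin_diff closedin_topspace topspace_euclidean_subtopology)
  then have "compact A" using K by (rule closedin_compact[rotated])
  moreover have "A \<noteq> {}" using \<tau>m(1) m by (auto simp: A_def)
  moreover have "continuous_on A Im" by (intro continuous_intros)
  ultimately obtain \<tau>0 where \<tau>0: "\<tau>0 \<in> A" "\<And>\<tau>. \<tau> \<in> A \<Longrightarrow> Im \<tau> \<le> Im \<tau>0"
    using continuous_attains_sup[of A Im] by blast
  have \<tau>0H: "\<tau>0 \<in> H" using \<tau>0(1) by (simp add: A_def K_def)
  have w0: "w \<tau>0 = ereal m" using \<tau>0(1) w_max[OF \<tau>0H] by (simp add: A_def)
  have w_strict: "w \<tau> < ereal m" if "Im \<tau>0 < Im \<tau>" for \<tau>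
  proof -
    have "\<tau> \<in> H" using that \<tau>0H by (simp add: H_def)
    moreover have "\<tau> \<notin> A" using that \<tau>0(2)[of \<tau>] by auto
    ultimately show ?thesis using far[of \<tau>] by (cases "cmod \<tau> \<le> R") (auto simp: A_def K_def)
  qed
  define r where "r = Im \<tau>0"
  have r: "0 < r"
  proof -
    have "Im \<tau>0 \<noteq> 0" using w_real[of \<tau>0] w0 cm m c(1) by auto
    then show ?thesis using \<tau>0H by (simp add: r_def H_def)
  qed
  define T where "T t = \<tau>0 + of_real r * cis t" for t
  have contT: "continuous_on UNIV T" unfolding T_def[abs_def] by (intro continuous_intros)
  have TH: "T t \<in> H" for t
  proof -
    have "r * (- 1) \<le> r * sin t" using r by (intro mult_left_mono) auto
    then show ?thesis by (simp add: T_def H_def r_def)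
  qed
  have "w (T (pi / 2)) < ereal m" using r by (intro w_strict) (simp add: T_def r_def)
  then obtain c' where c': "w (T (pi / 2)) < ereal c'" "c' < m" using ereal_dense2 by force
  have "usc_on UNIV (\<lambda>t. w (T t))"
    using usc_on_compose[OF usc_w contT] TH by auto
  then have "open {t. w (T t) < ereal c'}" by (simp add: usc_on_def)
  then obtain \<epsilon> where "0 < \<epsilon>" "ball (pi / 2) \<epsilon> \<subseteq> {t. w (T t) < ereal c'}"
    using openE c'(1) by blast
  then have \<epsilon>: "0 < \<epsilon>" "\<And>t. \<bar>t - pi / 2\<bar> < \<epsilon> \<Longrightarrow> w (T t) < ereal c'"
    by (auto simp: dist_real_def abs_minus_commute subset_iff)
  define \<eta> where "\<eta> = min (\<epsilon> / 2) 1"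
  have \<eta>: "0 < \<eta>" "\<eta> < \<epsilon>" "\<eta> \<le> 1" using \<epsilon>(1) by (auto simp: \<eta>_def)
  define I where "I = {pi / 2 - \<eta>..pi / 2 + \<eta>}"
  \<comment> \<open>A real majorant on the circle, below the trivial one on a short arc around the top point.\<close>
  define k where "k t = (m + h (T t)) - (m - c') * indicator I t" for t
  let ?U = "uniform_measure lborel {0..2 * pi} :: real measure"
  have wk: "w (T t) + ereal (h (T t)) \<le> ereal (k t)" for t
  proof -
    have "w (T t) \<le> ereal (m - (m - c') * indicator I t)"
    proof (cases "t \<in> I")
      case True
      then have "\<bar>t - pi / 2\<bar> < \<epsilon>" using \<eta> by (auto simp: I_def)
      then show ?thesis using \<epsilon>(2)[of t] True by simp
    next
      case False
      then show ?thesis using w_max[OF TH] by simp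
    qed
    then show ?thesis unfolding k_def by (cases "w (T t)") auto
  qed
  have conth: "continuous_on UNIV (\<lambda>t. m + h (T t))"
    using cont_h[OF r[unfolded r_def]] unfolding T_def r_def by (intro continuous_intros)
  have int_h: "integral {0..2 * pi} (\<lambda>t. m + h (T t)) = 2 * pi * (m + h \<tau>0)"
    using has_integral_add[OF has_integral_const_real[of m 0 "2 * pi"] mean_h[OF r[unfolded r_def]]]
    unfolding T_def r_def by (intro integral_unique) (simp add: algebra_simps)
  have sub: "I \<subseteq> {0..2 * pi}" using \<eta> pi_gt3 by (auto simp: I_def)
  have mI: "measure ?U I = \<eta> / pi"
  proof -
    have "measure ?U I = measure lborel ({0..2 * pi} \<inter> I) / measure lborel {0..2 * pi}"
      by (rule measure_uniform_measure) (auto simp: I_def)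
    also have "{0..2 * pi} \<inter> I = I" using sub by auto
    finally show ?thesis using \<eta>(1) by (simp add: I_def)
  qed
  have int_I: "integrable ?U (\<lambda>t. (m - c') * indicator I t)"
  proof -
    have "emeasure ?U I < \<infinity>" using mI \<eta>(1) by (auto simp: measure_def less_top)
    then show ?thesis by (intro integrable_mult_right integrable_real_indicator) (auto simp: I_def)
  qed
  have int_k: "integrable ?U k" "integral\<^sup>L ?U k = (m + h \<tau>0) - (m - c') * (\<eta> / pi)"
    using circle_integrable[OF conth] int_I mI
    unfolding k_def[abs_def] by (auto simp: int_h)
  have "ereal (m + h \<tau>0) = w \<tau>0 + ereal (h \<tau>0)" using w0 by simp
  also have "\<dots> \<le> ereal_integral ?U (\<lambda>t. w (T t) + ereal (h (T t)))"
    using submean[OF r[unfolded r_def]] unfolding T_def r_def .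
  also have "\<dots> \<le> ereal_integral ?U (\<lambda>t. ereal (k t))" by (rule ereal_integral_mono) (rule wk)
  also have "\<dots> = ereal ((m + h \<tau>0) - (m - c') * (\<eta> / pi))"
    by (simp add: ereal_integral_ereal int_k)
  finally have "(m - c') * (\<eta> / pi) \<le> 0" by simp
  moreover have "0 < (m - c') * (\<eta> / pi)" using c'(2) \<eta>(1) by simp
  ultimately show False by simp
qed

section \<open>The upper bound on complexified real lines\<close>

lemma PSH_omega_usc: "\<phi> \<in> PSH_omega \<Longrightarrow> usc_on UNIV \<phi>"
  by (simp add: PSH_omega_def)

text \<open>The sub-mean value inequality of the $j$-th chart, written in homogeneous coordinates.  The
  direction has to keep the $j$-th coordinate fixed for the disc to be a disc in the chart.\<close>

lemma PSH_omega_submean: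
  assumes \<phi>: "\<phi> \<in> PSH_omega" and P: "P $ j = 1" and W: "W $ j = 0"
  shows "\<phi> (point P) + ereal (ln (norm P))
    \<le> ereal_integral (uniform_measure lborel {0..2 * pi})
        (\<lambda>t. \<phi> (point (P + cis t *s W)) + ereal (ln (norm (P + cis t *s W))))"
proof -
  obtain a where a: "P = chart_vec j 1 a" using chart_vec_surj[of P j] P by metis
  obtain b where b: "W = chart_vec j 0 b" using chart_vec_surj[of W j] W by metis
  have "plurisubharmonic_on UNIV (\<lambda>z. \<phi> (affine_chart j z) + ereal (u0 z))"
    using \<phi> by (simp add: PSH_omega_def)
  then have "\<phi> (affine_chart j a) + ereal (u0 a)
      \<le> ereal_integral (uniform_measure lborel {0..2 * pi})
          (\<lambda>t. \<phi> (affine_chart j (a + cis t *s b)) + ereal (u0 (a + cis t *s b)))"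
    unfolding plurisubharmonic_on_def by blast
  then show ?thesis
    by (simp add: affine_chart_eq u0_eq_ln_norm[of _ j] a b chart_vec_affine)
qed

lemma PSH_omega_less_top:
  assumes \<phi>: "\<phi> \<in> PSH_omega" and P: "P $ j = 1"
  shows "\<phi> (point P) < \<infinity>"
proof -
  obtain a where a: "P = chart_vec j 1 a" using chart_vec_surj[of P j] P by metis
  have "\<phi> (affine_chart j a) + ereal (u0 a) < \<infinity>"
    using \<phi> by (simp add: PSH_omega_def plurisubharmonic_on_def)
  then show ?thesis by (simp add: a affine_chart_eq)
qed

lemma norm_real_line:
  assumes "X \<bullet> Y = 0"
  shows "(norm (cvec X + \<tau> *s cvec Y))\<^sup>2 = (norm X)\<^sup>2 + (cmod \<tau>)\<^sup>2 * (norm Y)\<^sup>2"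
proof -
  have "Re_vec (cvec X + \<tau> *s cvec Y) = X + Re \<tau> *\<^sub>R Y" "Im_vec (cvec X + \<tau> *s cvec Y) = Im \<tau> *\<^sub>R Y"
    by (simp_all add: Re_vec_def Im_vec_def cvec_def vec_eq_iff)
  then have "(norm (cvec X + \<tau> *s cvec Y))\<^sup>2 = (norm (X + Re \<tau> *\<^sub>R Y))\<^sup>2 + (norm (Im \<tau> *\<^sub>R Y))\<^sup>2"
    by (simp only: norm_sq_Re_Im[of "cvec X + \<tau> *s cvec Y"])
  also have "\<dots> = (X + Re \<tau> *\<^sub>R Y) \<bullet> (X + Re \<tau> *\<^sub>R Y) + (Im \<tau>)\<^sup>2 * (Y \<bullet> Y)"
    by (simp only: norm_scaleR power_mult_distrib power2_abs power2_norm_eq_inner)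
  also have "\<dots> = (norm X)\<^sup>2 + (cmod \<tau>)\<^sup>2 * (norm Y)\<^sup>2"
    using assms unfolding cmod_power2 power2_norm_eq_inner
    by (simp add: inner_add_left inner_add_right inner_commute power2_eq_square algebra_simps)
  finally show ?thesis .
qed

text \<open>On the right is $\log L(X + \tau Y)$, which for real \<open>\<tau>\<close> is $\log|X + \tau Y|$ and which is harmonic
  for ${\rm Im}\,\tau > 0$.  The maximum principle applies to the difference of the two sides.  The
  difference is at most $\phi$, since $|X + \tau Y| \le \bigl||X| - i\tau|Y|\bigr|$ in the half plane; this
  settles the boundary values on the real axis, and those at infinity too, where the limit point
  $[Y]$ is real and \<open>\<phi>\<close> is upper semicontinuous.\<close>

lemma half_plane_bound:
  fixes \<phi> :: "'n::finite option cproj \<Rightarrow> ereal" and X Y :: "real ^ 'n option"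
  assumes \<phi>: "\<phi> \<in> PSH_omega" and real_le: "\<forall>p\<in>real_points. \<phi> p \<le> 0"
    and X: "X $ j = 1" and Y: "Y $ j = 0" "Y \<noteq> 0" and orth: "X \<bullet> Y = 0" and \<tau>1: "0 \<le> Im \<tau>1"
  shows "\<phi> (point (cvec X + \<tau>1 *s cvec Y)) + ereal (ln (norm (cvec X + \<tau>1 *s cvec Y)))
    \<le> ereal (ln (cmod (of_real (norm X) - \<i> * \<tau>1 * of_real (norm Y))))"
proof -
  define V where "V \<tau> = cvec X + \<tau> *s cvec Y" for \<tau>
  define l where "l \<tau> = of_real (norm X) - \<i> * \<tau> * of_real (norm Y)" for \<tau>
  define h where "h \<tau> = ln (cmod (l \<tau>))" for \<tau>
  define H where "H = {\<tau>. 0 \<le> Im \<tau>}"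
  define w where "w \<tau> = \<phi> (point (V \<tau>)) + ereal (ln (norm (V \<tau>)) - h \<tau>)" for \<tau>
  have X0: "0 < norm X" using X by auto
  have Vj: "V \<tau> $ j = 1" for \<tau> using X Y by (simp add: V_def cvec_def)
  then have V0: "V \<tau> \<noteq> 0" for \<tau> by (metis zero_index zero_neq_one)
  have Re_l: "norm X + Im \<tau> * norm Y \<le> cmod (l \<tau>)" for \<tau>
    using complex_Re_le_cmod[of "l \<tau>"] by (simp add: l_def)
  have l_pos: "0 < cmod (l \<tau>)" if "\<tau> \<in> H" for \<tau>
  proof -
    have "0 \<le> Im \<tau> * norm Y" using that by (simp add: H_def)
    then show ?thesis using Re_l[of \<tau>] X0 by linarith
  qed
  have smult: "\<tau> *s Z = (\<chi> i. \<tau> * Z $ i)" for \<tau> :: complex and Z :: "complex ^ 'n option"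
    by (simp add: vec_eq_iff)
  have contV: "continuous_on S V" for S
    unfolding V_def[abs_def] smult by (intro continuous_intros continuous_on_vec_lambda)
  have usc_w: "usc_on H w"
  proof -
    have "usc_on H (\<lambda>\<tau>. \<phi> (point (V \<tau>)))"
      by (intro usc_on_compose[OF PSH_omega_usc[OF \<phi>]] continuous_on_compose2[OF continuous_on_point] contV)
        (auto simp: V0)
    moreover have "continuous_on H (\<lambda>\<tau>. ln (norm (V \<tau>)) - h \<tau>)"
      unfolding h_def l_def
      by (intro continuous_intros contV) (use V0 l_pos in \<open>auto simp: l_def\<close>)
    ultimately show ?thesis unfolding w_def[abs_def] by (rule usc_on_add_continuous)
  qed
  have w_le: "w \<tau> \<le> \<phi> (point (V \<tau>))" if "\<tau> \<in> H" for \<tau>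
  proof -
    have "(norm (V \<tau>))\<^sup>2 \<le> (cmod (l \<tau>))\<^sup>2"
    proof -
      have "(cmod (l \<tau>))\<^sup>2 = (norm X + Im \<tau> * norm Y)\<^sup>2 + (Re \<tau> * norm Y)\<^sup>2"
        by (simp add: l_def cmod_power2)
      also have "\<dots> = (norm V')\<^sup>2 + 2 * (norm X * (Im \<tau> * norm Y))" if "V' = V \<tau>" for V'
        unfolding that V_def norm_real_line[OF orth] cmod_power2 by (simp add: power2_eq_square algebra_simps)
      finally show ?thesis using that by (simp add: H_def)
    qed
    then have "ln (norm (V \<tau>)) \<le> h \<tau>"
      unfolding h_def using V0[of \<tau>] l_pos[OF that] by (intro ln_mono) (auto dest: power2_le_imp_le)
    then show ?thesis unfolding w_def by (cases "\<phi> (point (V \<tau>))") auto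
  qed
  have w_real: "w \<tau> \<le> 0" if "Im \<tau> = 0" for \<tau>
  proof -
    have "V \<tau> = cvec (X + Re \<tau> *\<^sub>R Y)"
      using that by (simp add: V_def cvec_def vec_eq_iff complex_eq_iff)
    moreover from this V0 have "X + Re \<tau> *\<^sub>R Y \<noteq> 0" by (metis cvec_eq_0_iff)
    ultimately have "point (V \<tau>) \<in> real_points" by (simp add: point_cvec_in_real_points)
    then have "\<phi> (point (V \<tau>)) \<le> 0" using real_le by blast
    moreover have "\<tau> \<in> H" using that by (simp add: H_def)
    ultimately show ?thesis using w_le order_trans by blast
  qed
  have w_infinity: "\<exists>R. \<forall>\<tau>\<in>H. R \<le> cmod \<tau> \<longrightarrow> w \<tau> < ereal c" if c: "0 < c" for c
  proof -
    \<comment> \<open>The coordinate \<open>\<sigma> = 1 / \<tau>\<close> of the line near its point at infinity.\<close>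
    define U where "U \<sigma> = cvec Y + \<sigma> *s cvec X" for \<sigma>
    have Uj: "U \<sigma> $ j = \<sigma>" for \<sigma> using X Y by (simp add: U_def cvec_def)
    have U0: "U \<sigma> \<noteq> 0" for \<sigma>
    proof (cases "\<sigma> = 0")
      case True
      then show ?thesis using Y(2) by (simp add: U_def cvec_eq_0_iff)
    next
      case False
      then show ?thesis using Uj[of \<sigma>] by (metis zero_index)
    qed
    have "continuous_on UNIV U"
      unfolding U_def[abs_def] smult by (intro continuous_intros continuous_on_vec_lambda)
    then have "usc_on UNIV (\<lambda>\<sigma>. \<phi> (point (U \<sigma>)))"
      by (intro usc_on_compose[OF PSH_omega_usc[OF \<phi>]] continuous_on_compose2[OF continuous_on_point])
        (auto simp: U0)
    then have "open {\<sigma>. \<phi> (point (U \<sigma>)) < ereal c}" by (simp add: usc_on_def)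
    moreover have "\<phi> (point (U 0)) < ereal c"
    proof -
      have "point (U 0) \<in> real_points" using Y(2) by (auto simp: U_def real_points_eq)
      then have "\<phi> (point (U 0)) \<le> 0" using real_le by blast
      also have "\<dots> < ereal c" using c by simp
      finally show ?thesis .
    qed
    ultimately obtain \<delta> where "0 < \<delta>" "ball 0 \<delta> \<subseteq> {\<sigma>. \<phi> (point (U \<sigma>)) < ereal c}"
      using openE by blast
    then have \<delta>: "0 < \<delta>" "\<And>\<sigma>. cmod \<sigma> < \<delta> \<Longrightarrow> \<phi> (point (U \<sigma>)) < ereal c" by auto
    show ?thesis
    proof (intro exI[of _ "2 / \<delta>"] ballI impI)
      fix \<tau> assume \<tau>: "\<tau> \<in> H" "2 / \<delta> \<le> cmod \<tau>"
      have "0 < 2 / \<delta>" using \<delta>(1) by simp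
      then have pos: "0 < cmod \<tau>" using \<tau>(2) by linarith
      then have \<tau>0: "\<tau> \<noteq> 0" by auto
      have "cmod (1 / \<tau>) < \<delta>" using \<tau>(2) \<delta>(1) pos by (simp add: norm_divide divide_simps mult.commute)
      moreover have "U (1 / \<tau>) = (1 / \<tau>) *s V \<tau>"
        using \<tau>0 by (simp add: U_def V_def vec_eq_iff field_simps)
      then have "point (U (1 / \<tau>)) = point (V \<tau>)" using \<tau>0 V0 by (simp add: point_scale)
      ultimately have "\<phi> (point (V \<tau>)) < ereal c" using \<delta>(2) by metis
      with w_le[OF \<tau>(1)] show "w \<tau> < ereal c" by (rule le_less_trans)
    qed
  qed
  have lT: "l (\<tau> + of_real (Im \<tau>) * cis t) = l \<tau> + (- \<i> * of_real (Im \<tau>) * of_real (norm Y)) * cis t" for \<tau> t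
    by (simp add: l_def algebra_simps)
  have TH: "\<tau> + of_real (Im \<tau>) * cis t \<in> H" if "0 < Im \<tau>" for \<tau> t
  proof -
    have "Im \<tau> * (- 1) \<le> Im \<tau> * sin t" using that by (intro mult_left_mono) auto
    then show ?thesis by (simp add: H_def)
  qed
  have w_h: "w \<tau> + ereal (h \<tau>) = \<phi> (point (V \<tau>)) + ereal (ln (norm (V \<tau>)))" for \<tau>
    unfolding w_def by (cases "\<phi> (point (V \<tau>))") auto
  have "w \<tau>1 \<le> 0"
  proof (rule half_plane_maximum_principle[where h = h], fold H_def)
    show "usc_on H w" by (rule usc_w)
    show "w \<tau> \<le> 0" if "Im \<tau> = 0" for \<tau> using that by (rule w_real)
    show "\<exists>R. \<forall>\<tau>\<in>H. R \<le> cmod \<tau> \<longrightarrow> w \<tau> < ereal c" if "0 < c" for c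
      using that by (rule w_infinity)
    show "\<tau>1 \<in> H" using \<tau>1 by (simp add: H_def)
    show "w \<tau> < \<infinity>" for \<tau> using PSH_omega_less_top[OF \<phi> Vj, of \<tau>] unfolding w_def by simp
    fix \<tau> :: complex assume \<tau>: "0 < Im \<tau>"
    show "continuous_on UNIV (\<lambda>t. h (\<tau> + of_real (Im \<tau>) * cis t))"
      unfolding h_def using l_pos[OF TH[OF \<tau>]]
      by (intro continuous_intros) (auto simp: lT intro!: continuous_intros)
    have "cmod (- \<i> * of_real (Im \<tau>) * of_real (norm Y)) = Im \<tau> * norm Y"
      using \<tau> by (simp add: norm_mult)
    then have "cmod (- \<i> * of_real (Im \<tau>) * of_real (norm Y)) < cmod (l \<tau>)"
      using Re_l[of \<tau>] X0 by linarith
    from has_integral_ln_norm_affine[OF this]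
    show "((\<lambda>t. h (\<tau> + of_real (Im \<tau>) * cis t)) has_integral 2 * pi * h \<tau>) {0..2 * pi}"
      by (simp add: h_def lT)
    have V_circle: "V \<tau> + cis t *s (of_real (Im \<tau>) *s cvec Y) = V (\<tau> + of_real (Im \<tau>) * cis t)" for t
      by (simp add: V_def vec_eq_iff algebra_simps)
    show "w \<tau> + ereal (h \<tau>) \<le> ereal_integral (uniform_measure lborel {0..2 * pi})
        (\<lambda>t. w (\<tau> + of_real (Im \<tau>) * cis t) + ereal (h (\<tau> + of_real (Im \<tau>) * cis t)))"
      using PSH_omega_submean[OF \<phi> Vj[of \<tau>], of "of_real (Im \<tau>) *s cvec Y"] Y
      unfolding w_h V_circle by (simp add: cvec_def)
  qed
  then have "\<phi> (point (V \<tau>1)) + ereal (ln (norm (V \<tau>1))) \<le> ereal (h \<tau>1)"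
    unfolding w_def by (cases "\<phi> (point (V \<tau>1))") auto
  then show ?thesis by (simp add: V_def h_def l_def)
qed

text \<open>After normalising a coordinate to $1$, the line through the point in the direction of its imaginary
  part $Y$ stays in one chart.  Orthogonalising the real part along this line moves the parameter
  from $i$ to $s + i$ with $s$ real.\<close>

lemma le_lie_fun:
  fixes \<phi> :: "'n::finite option cproj \<Rightarrow> ereal"
  assumes \<phi>: "\<phi> \<in> PSH_omega" and real_le: "\<forall>p\<in>real_points. \<phi> p \<le> 0"
  shows "\<phi> p \<le> ereal (lie_fun p)"
proof -
  obtain v where v: "v \<noteq> 0" "p = point v" by (rule cproj_cases)
  then obtain j where j: "v $ j \<noteq> 0" by (auto simp: vec_eq_iff)
  define Z where "Z = (1 / v $ j) *s v"
  have Zj: "Z $ j = 1" using j by (simp add: Z_def)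
  then have Z0: "Z \<noteq> 0" by (metis zero_index zero_neq_one)
  have p: "p = point Z" using j v by (simp add: Z_def point_scale)
  let ?X = "Re_vec Z" and ?Y = "Im_vec Z"
  show ?thesis
  proof (cases "?Y = 0")
    case True
    moreover have "cvec (0 :: real ^ 'n option) = 0" by (simp add: cvec_eq_0_iff)
    ultimately have "Z = cvec ?X" using complex_vec_eq[of Z] by simp
    moreover from this Z0 have "?X \<noteq> 0" by (metis cvec_eq_0_iff)
    ultimately have "p \<in> real_points" unfolding p by (metis point_cvec_in_real_points)
    then have "\<phi> p \<le> 0" using real_le by blast
    also have "0 \<le> ereal (lie_fun p)" using lie_fun_bounds(1) by simp
    finally show ?thesis .
  next
    case False
    define s where "s = (?X \<bullet> ?Y) / (?Y \<bullet> ?Y)"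
    define \<tau> where "\<tau> = Complex s 1"
    have Yj: "?Y $ j = 0" using Zj by (simp add: Im_vec_def)
    have Xj: "perp ?X ?Y $ j = 1" using Zj by (simp add: perp_def Re_vec_def Im_vec_def)
    have Z: "cvec (perp ?X ?Y) + \<tau> *s cvec ?Y = Z"
      by (simp add: vec_eq_iff complex_eq_iff cvec_def perp_def s_def \<tau>_def Re_vec_def Im_vec_def)
    have "(cmod (of_real (norm (perp ?X ?Y)) - \<i> * \<tau> * of_real (norm ?Y)))\<^sup>2 = lie_sq Z"
      unfolding lie_sq_eq norm_perp[of ?X ?Y] s_def[symmetric]
      by (simp add: cmod_power2 \<tau>_def) (simp add: power2_eq_square algebra_simps)
    then have l: "cmod (of_real (norm (perp ?X ?Y)) - \<i> * \<tau> * of_real (norm ?Y)) = sqrt (lie_sq Z)"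
      by (metis norm_ge_zero real_sqrt_unique)
    have "\<phi> p + ereal (ln (norm Z)) \<le> ereal (ln (sqrt (lie_sq Z)))"
      using half_plane_bound[OF \<phi> real_le Xj Yj False inner_perp, of \<tau>]
      unfolding Z l p by (simp add: \<tau>_def)
    then show ?thesis
      using lie_fun_point'[OF Z0] unfolding p by (cases "\<phi> (point Z)") auto
  qed
qed

lemma extremal_fun_real_points:
  "extremal_fun real_points (\<lambda>_. 0) (p :: 'n::finite option cproj) = ereal (lie_fun p)"
  unfolding extremal_fun_def
proof (rule antisym)
  show "(SUP \<phi>\<in>{\<phi> \<in> PSH_omega. \<forall>x\<in>real_points. \<phi> x \<le> 0}. \<phi> p) \<le> ereal (lie_fun p)"
    by (rule SUP_least) (auto intro: le_lie_fun)
  have "ereal (lie_fun x) \<le> 0" if "x \<in> real_points" for x :: "'n option cproj"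
    using that by (auto simp: real_points_eq cvec_eq_0_iff lie_fun_point lie_sq_cvec)
  then show "ereal (lie_fun p) \<le> (SUP \<phi>\<in>{\<phi> \<in> PSH_omega. \<forall>x\<in>real_points. \<phi> x \<le> 0}. \<phi> p)"
    using SUP_upper[of "\<lambda>p. ereal (lie_fun p)" "{\<phi> \<in> PSH_omega. \<forall>x\<in>real_points. \<phi> x \<le> 0}" "\<lambda>\<phi>. \<phi> p"]
      lie_fun_in_PSH_omega by auto
qed

lemma lie_sq_quotient:
  assumes "v \<noteq> 0"
  shows "lie_sq v / (norm v)\<^sup>2 = 1 + sqrt (1 - (cmod (csquare v))\<^sup>2 / ((norm v)\<^sup>2)\<^sup>2)"
proof -
  define N where "N = (norm v)\<^sup>2"
  have N: "0 < N" using assms by (simp add: N_def)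
  have "1 - (cmod (csquare v))\<^sup>2 / N\<^sup>2 = (N\<^sup>2 - (cmod (csquare v))\<^sup>2) / N\<^sup>2"
    using N by (simp add: diff_divide_distrib)
  then have "sqrt (1 - (cmod (csquare v))\<^sup>2 / N\<^sup>2) = sqrt (N\<^sup>2 - (cmod (csquare v))\<^sup>2) / N"
    using N by (simp add: real_sqrt_divide)
  then show ?thesis
    using N unfolding lie_sq_def N_def[symmetric] by (simp add: add_divide_distrib)
qed

theorem corollary5p2:
  shows
    "(\<forall>z :: complex ^ 'n.
        extremal_fun real_points (\<lambda>_. 0) (point (hom_coords 1 z)) =
          ereal (1/2 * ln ((1 + (norm z)\<^sup>2)
                   + sqrt ((1 + (norm z)\<^sup>2)\<^sup>2 - (cmod (1 + csquare z))\<^sup>2)) - u0 z)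
      \<and> 1/2 * ln ((1 + (norm z)\<^sup>2)
                   + sqrt ((1 + (norm z)\<^sup>2)\<^sup>2 - (cmod (1 + csquare z))\<^sup>2)) - u0 z
        = 1/2 * ln (1 + sqrt (1 - (cmod (1 + csquare z))\<^sup>2 / (1 + (norm z)\<^sup>2)\<^sup>2)))
   \<and> (\<forall>z :: complex ^ 'n. z \<noteq> 0 \<longrightarrow>
        extremal_fun real_points (\<lambda>_. 0) (point (hom_coords 0 z)) =
          ereal (1/2 * ln (1 + sqrt (1 - (cmod (csquare z))\<^sup>2 / ((norm z)\<^sup>2)\<^sup>2))))"
proof (intro conjI allI impI)
  fix z :: "complex ^ 'n"
  let ?v = "hom_coords 1 z"
  let ?q = "1/2 * ln ((1 + (norm z)\<^sup>2) + sqrt ((1 + (norm z)\<^sup>2)\<^sup>2 - (cmod (1 + csquare z))\<^sup>2)) - u0 z"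
  let ?r = "1/2 * ln (1 + sqrt (1 - (cmod (1 + csquare z))\<^sup>2 / (1 + (norm z)\<^sup>2)\<^sup>2))"
  have v: "?v \<noteq> 0" using chart_vec_nonzero[of 1 None z] by (simp add: chart_vec_None)
  have n: "(norm ?v)\<^sup>2 = 1 + (norm z)\<^sup>2" using norm_chart_vec[of None 1 z] by (simp add: chart_vec_None)
  have sq: "lie_sq ?v = (1 + (norm z)\<^sup>2) + sqrt ((1 + (norm z)\<^sup>2)\<^sup>2 - (cmod (1 + csquare z))\<^sup>2)"
    by (simp add: lie_sq_def n csquare_hom_coords)
  have "lie_fun (point ?v) = ?r"
    unfolding lie_fun_point[OF v] lie_sq_quotient[OF v] unfolding n csquare_hom_coords by simp
  moreover have "lie_fun (point ?v) = ?q"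
  proof -
    have "lie_fun (point ?v) = 1/2 * ln (lie_sq ?v) - 1/2 * ln ((norm ?v)\<^sup>2)"
      using v lie_sq_pos[OF v] by (simp add: lie_fun_point ln_div)
    then show ?thesis unfolding sq n u0_def .
  qed
  ultimately show "extremal_fun real_points (\<lambda>_. 0) (point ?v) = ereal ?q" "?q = ?r"
    by (simp_all only: extremal_fun_real_points)
next
  fix z :: "complex ^ 'n"
  assume "z \<noteq> 0"
  let ?v = "hom_coords 0 z"
  have n: "(norm ?v)\<^sup>2 = (norm z)\<^sup>2" using norm_chart_vec[of None 0 z] by (simp add: chart_vec_None)
  then have v: "?v \<noteq> 0" using \<open>z \<noteq> 0\<close> by auto
  show "extremal_fun real_points (\<lambda>_. 0) (point ?v)
      = ereal (1/2 * ln (1 + sqrt (1 - (cmod (csquare z))\<^sup>2 / ((norm z)\<^sup>2)\<^sup>2)))"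
    using lie_sq_quotient[OF v] unfolding extremal_fun_real_points lie_fun_point[OF v] n
    by (simp add: csquare_hom_coords)
qed

end
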